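(* Let $E$ be a finite graph and $K$ a field. Then the Cohn path algebra $C_K(E)$ has Invariant Basis Number.
   Context: A (directed) graph $E=(E^0,E^1,s,r)$ consists of two disjoint sets $E^0$ (vertices) and $E^1$ (edges) and maps $s,r:E^1\to E^0$ (source and range). It is finite if $E^0$ and $E^1$ are finite; $E^0$ is assumed nonempty. For a field $K$, the Cohn path algebra $C_K(E)$ is the $K$-algebra generated by $\{v,e,e^*\mid v\in E^0,e\in E^1\}$ subject to, for all $v,w\in E^0$, $e,f\in E^1$: (1) $vw=\delta_{v,w}w$; (2) $s(e)e=e=e\,r(e)$ and $r(e)e^*=e^*=e^*s(e)$; (3) $e^*f=\delta_{e,f}r(e)$. For finite $E$ it is unital with identity $\sum_{v\in E^0}v$. A unital ring $R$ has Invariant Basis Number if for all positive integers $m,n$, $R^m\cong R^n$ as right $R$-modules implies $m=n$. *)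

theory Defs
  imports
    "HOL-Library.Poly_Mapping"
    "HOL-Library.FuncSet"
    "HOL-Algebra.QuotRing"
    "Graph_Theory.Digraph"
begin

(* A copy of the list type carrying concatenation as (noncommutative) addition, so that
   'a free_monoid =>\<^sub>0 'k is the free unital associative algebra on 'a
   with the convolution product of Poly_Mapping. *)

datatype 'a free_monoid = Word (letters: "'a list")

instantiation free_monoid :: (type) monoid_add
begin

definition zero_free_monoid :: "'a free_monoid"
  where "0 = Word []"

definition plus_free_monoid :: "'a free_monoid \<Rightarrow> 'a free_monoid \<Rightarrow> 'a free_monoid"
  where "u + v = Word (letters u @ letters v)"

instance
  by standard (simp_all add: zero_free_monoid_def plus_free_monoid_def)

end

type_synonym ('g, 'k) free_alg = "'g free_monoid \<Rightarrow>\<^sub>0 'k"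

definition gen :: "'g \<Rightarrow> ('g, 'k::field) free_alg"
  where "gen x = Poly_Mapping.single (Word [x]) 1"

definition scalar :: "'k::field \<Rightarrow> ('g, 'k) free_alg"
  where "scalar c = Poly_Mapping.single 0 c"

(* Free non-unital K-algebra on X: linear combinations of nonempty words.
   The unit of the ambient type is not in the carrier; the field one of the record is junk. *)
definition free_algebra :: "'g set \<Rightarrow> ('g, 'k::field) free_alg ring"
  where "free_algebra X =
    \<lparr>carrier = {a. \<forall>w \<in> Poly_Mapping.keys a. letters w \<noteq> [] \<and> set (letters w) \<subseteq> X},
     mult = (*), one = 1, zero = 0, add = (+)\<rparr>"

(* Two-sided K-algebra ideal generated by S.  Closure under scalars is separate
   because the free algebra has no unit; genideal from HOL-Algebra presupposes one. *)
inductive_set alg_ideal :: "'g set \<Rightarrow> ('g, 'k::field) free_alg set \<Rightarrow> ('g, 'k) free_alg set"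
  for X :: "'g set" and S :: "('g, 'k) free_alg set"
where
  zero: "0 \<in> alg_ideal X S"
| base: "a \<in> S \<Longrightarrow> a \<in> alg_ideal X S"
| add: "a \<in> alg_ideal X S \<Longrightarrow> b \<in> alg_ideal X S \<Longrightarrow> a + b \<in> alg_ideal X S"
| scale: "a \<in> alg_ideal X S \<Longrightarrow> scalar c * a \<in> alg_ideal X S"
| left: "a \<in> alg_ideal X S \<Longrightarrow> x \<in> carrier (free_algebra X) \<Longrightarrow> x * a \<in> alg_ideal X S"
| right: "a \<in> alg_ideal X S \<Longrightarrow> x \<in> carrier (free_algebra X) \<Longrightarrow> a * x \<in> alg_ideal X S"

datatype ('v, 'e) cohn_gen = Vert 'v | Edge 'e | Ghost 'e

definition cohn_gens :: "('v, 'e) pre_digraph \<Rightarrow> ('v, 'e) cohn_gen set"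
  where "cohn_gens E = Vert ` verts E \<union> Edge ` arcs E \<union> Ghost ` arcs E"

(* Each defining equation x = y is encoded as the element x - y. *)
definition cohn_relations ::
    "('v, 'e) pre_digraph \<Rightarrow> (('v, 'e) cohn_gen, 'k::field) free_alg set"
  where "cohn_relations E =
      {gen (Vert v) * gen (Vert w) - (if v = w then gen (Vert w) else 0) | v w.
         v \<in> verts E \<and> w \<in> verts E}
    \<union> {gen (Vert (tail E e)) * gen (Edge e) - gen (Edge e) | e. e \<in> arcs E}
    \<union> {gen (Edge e) * gen (Vert (head E e)) - gen (Edge e) | e. e \<in> arcs E}
    \<union> {gen (Vert (head E e)) * gen (Ghost e) - gen (Ghost e) | e. e \<in> arcs E}
    \<union> {gen (Ghost e) * gen (Vert (tail E e)) - gen (Ghost e) | e. e \<in> arcs E}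
    \<union> {gen (Ghost e) * gen (Edge f) - (if e = f then gen (Vert (head E e)) else 0) | e f.
         e \<in> arcs E \<and> f \<in> arcs E}"

definition cohn_ideal ::
    "('v, 'e) pre_digraph \<Rightarrow> (('v, 'e) cohn_gen, 'k::field) free_alg set"
  where "cohn_ideal E = alg_ideal (cohn_gens E) (cohn_relations E)"

(* The coefficient field is the type 'k.  The unit, the class of the sum of all vertices,
   is meaningful for finite E only; see ring_cohn_path_algebra. *)
definition cohn_path_algebra ::
    "('v, 'e) pre_digraph \<Rightarrow> (('v, 'e) cohn_gen, 'k::field) free_alg set ring"
  where "cohn_path_algebra E =
    (free_algebra (cohn_gens E) Quot cohn_ideal E)
      \<lparr>one := cohn_ideal E +>\<^bsub>free_algebra (cohn_gens E)\<^esub> (\<Sum>v\<in>verts E. gen (Vert v))\<rparr>"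

definition power_carrier :: "('a, 'b) ring_scheme \<Rightarrow> nat \<Rightarrow> (nat \<Rightarrow> 'a) set"
  where "power_carrier R n = {..<n} \<rightarrow>\<^sub>E carrier R"

definition power_add ::
    "('a, 'b) ring_scheme \<Rightarrow> nat \<Rightarrow> (nat \<Rightarrow> 'a) \<Rightarrow> (nat \<Rightarrow> 'a) \<Rightarrow> (nat \<Rightarrow> 'a)"
  where "power_add R n x y = (\<lambda>i\<in>{..<n}. x i \<oplus>\<^bsub>R\<^esub> y i)"

definition power_rsmult :: "('a, 'b) ring_scheme \<Rightarrow> nat \<Rightarrow> (nat \<Rightarrow> 'a) \<Rightarrow> 'a \<Rightarrow> (nat \<Rightarrow> 'a)"
  where "power_rsmult R n x r = (\<lambda>i\<in>{..<n}. x i \<otimes>\<^bsub>R\<^esub> r)"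

definition right_module_iso ::
    "('a, 'b) ring_scheme \<Rightarrow> nat \<Rightarrow> nat \<Rightarrow> ((nat \<Rightarrow> 'a) \<Rightarrow> (nat \<Rightarrow> 'a)) \<Rightarrow> bool"
  where "right_module_iso R m n \<phi> \<longleftrightarrow>
    bij_betw \<phi> (power_carrier R m) (power_carrier R n) \<and>
    (\<forall>x \<in> power_carrier R m. \<forall>y \<in> power_carrier R m.
       \<phi> (power_add R m x y) = power_add R n (\<phi> x) (\<phi> y)) \<and>
    (\<forall>x \<in> power_carrier R m. \<forall>r \<in> carrier R.
       \<phi> (power_rsmult R m x r) = power_rsmult R n (\<phi> x) r)"

definition invariant_basis_number :: "('a, 'b) ring_scheme \<Rightarrow> bool"
  where "invariant_basis_number R \<longleftrightarrow> ring R \<and>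
    (\<forall>m n. 0 < m \<longrightarrow> 0 < n \<longrightarrow> (\<exists>\<phi>. right_module_iso R m n \<phi>) \<longrightarrow> m = n)"


lemma letters_zero [simp]: "letters 0 = []"
  by (simp add: zero_free_monoid_def)

lemma letters_plus [simp]: "letters (u + v) = letters u @ letters v"
  by (simp add: plus_free_monoid_def)

lemma free_algebra_simps [simp]:
  "mult (free_algebra X) = (*)" "add (free_algebra X) = (+)" "zero (free_algebra X) = 0"
  by (simp_all add: free_algebra_def)

lemma free_algebra_carrier:
  "a \<in> carrier (free_algebra X) \<longleftrightarrow>
    (\<forall>w \<in> Poly_Mapping.keys a. letters w \<noteq> [] \<and> set (letters w) \<subseteq> X)"
  by (simp add: free_algebra_def)

lemma fa_zero: "0 \<in> carrier (free_algebra X)"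
  by (simp add: free_algebra_carrier)

lemma fa_add:
  "a \<in> carrier (free_algebra X) \<Longrightarrow> b \<in> carrier (free_algebra X) \<Longrightarrow> a + b \<in> carrier (free_algebra X)"
  unfolding free_algebra_carrier using keys_add[of a b] by blast

lemma fa_uminus: "a \<in> carrier (free_algebra X) \<Longrightarrow> - a \<in> carrier (free_algebra X)"
  by (simp add: free_algebra_carrier keys_minus)

lemma fa_diff:
  "a \<in> carrier (free_algebra X) \<Longrightarrow> b \<in> carrier (free_algebra X) \<Longrightarrow> a - b \<in> carrier (free_algebra X)"
  using fa_add[of a X "- b"] fa_uminus[of b X] by simp

lemma fa_mult:
  assumes "a \<in> carrier (free_algebra X)" "b \<in> carrier (free_algebra X)"
  shows "a * b \<in> carrier (free_algebra X)"
  unfolding free_algebra_carrier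
proof
  fix w assume "w \<in> Poly_Mapping.keys (a * b)"
  then obtain u v where "w = u + v" "u \<in> Poly_Mapping.keys a" "v \<in> Poly_Mapping.keys b"
    using keys_mult[of a b] by blast
  then show "letters w \<noteq> [] \<and> set (letters w) \<subseteq> X"
    using assms by (auto simp: free_algebra_carrier)
qed

lemma fa_scalar:
  assumes "a \<in> carrier (free_algebra X)"
  shows "scalar c * a \<in> carrier (free_algebra X)"
  unfolding free_algebra_carrier
proof
  fix w assume "w \<in> Poly_Mapping.keys (scalar c * a)"
  then obtain u v where "w = u + v" "u \<in> Poly_Mapping.keys (scalar c :: ('a, 'b) free_alg)"
      "v \<in> Poly_Mapping.keys a"
    using keys_mult[of "scalar c" a] by blast
  then show "letters w \<noteq> [] \<and> set (letters w) \<subseteq> X"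
    using assms by (auto simp: free_algebra_carrier scalar_def split: if_splits)
qed

lemma fa_single:
  "ws \<noteq> [] \<Longrightarrow> set ws \<subseteq> X \<Longrightarrow> Poly_Mapping.single (Word ws) c \<in> carrier (free_algebra X)"
  by (simp add: free_algebra_carrier)

lemma fa_gen: "x \<in> X \<Longrightarrow> gen x \<in> carrier (free_algebra X)"
  unfolding gen_def by (rule fa_single) auto

lemma fa_sum: "(\<And>i. i \<in> A \<Longrightarrow> f i \<in> carrier (free_algebra X)) \<Longrightarrow> sum f A \<in> carrier (free_algebra X)"
  by (induction A rule: infinite_finite_induct) (auto intro: fa_zero fa_add)

lemma ai_uminus: "a \<in> alg_ideal X S \<Longrightarrow> - a \<in> alg_ideal X S"
  using alg_ideal.scale[of a X S "- 1"] by (simp add: scalar_def single_uminus)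

lemma ai_diff: "a \<in> alg_ideal X S \<Longrightarrow> b \<in> alg_ideal X S \<Longrightarrow> a - b \<in> alg_ideal X S"
  using alg_ideal.add[of a X S "- b"] ai_uminus[of b X S] by simp

lemma ai_sum: "(\<And>i. i \<in> A \<Longrightarrow> f i \<in> alg_ideal X S) \<Longrightarrow> sum f A \<in> alg_ideal X S"
  by (induction A rule: infinite_finite_induct) (auto intro: alg_ideal.zero alg_ideal.add)

lemma poly_mapping_sum_monomials:
  "(\<Sum>w\<in>Poly_Mapping.keys a. Poly_Mapping.single w (Poly_Mapping.lookup a w)) = a"
  by (rule poly_mapping_eqI)
    (simp add: lookup_sum lookup_single when_def in_keys_iff)

lemma scalar_commute: "scalar c * a = a * scalar c"
proof -
  have "scalar c * a = (\<Sum>w\<in>Poly_Mapping.keys a. scalar c * Poly_Mapping.single w (Poly_Mapping.lookup a w))"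
    by (subst poly_mapping_sum_monomials[symmetric, of a]) (simp add: sum_distrib_left)
  also have "\<dots> = (\<Sum>w\<in>Poly_Mapping.keys a. Poly_Mapping.single w (Poly_Mapping.lookup a w) * scalar c)"
    by (simp add: scalar_def mult_single mult.commute)
  also have "\<dots> = a * scalar c"
    by (subst (3) poly_mapping_sum_monomials[symmetric, of a]) (simp add: sum_distrib_right)
  finally show ?thesis .
qed

lemma ai_word_right:
  assumes "a \<in> alg_ideal X S" "set ws \<subseteq> X"
  shows "a * Poly_Mapping.single (Word ws) c \<in> alg_ideal X S"
proof (cases "ws = []")
  case True
  then show ?thesis
    using alg_ideal.scale[OF assms(1), of c] scalar_commute[of c a]
    by (simp add: scalar_def zero_free_monoid_def)
next
  case False
  then show ?thesis using assms by (intro alg_ideal.right fa_single)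
qed

lemma ai_word_left:
  assumes "a \<in> alg_ideal X S" "set ws \<subseteq> X"
  shows "Poly_Mapping.single (Word ws) c * a \<in> alg_ideal X S"
proof (cases "ws = []")
  case True
  then show ?thesis
    using alg_ideal.scale[OF assms(1), of c] by (simp add: scalar_def zero_free_monoid_def)
next
  case False
  then show ?thesis using assms by (intro alg_ideal.left fa_single)
qed

lemma ai_subset:
  assumes "S \<subseteq> carrier (free_algebra X)" "a \<in> alg_ideal X S"
  shows "a \<in> carrier (free_algebra X)"
  using assms(2)
  by induction (use assms(1) in \<open>auto intro: fa_zero fa_add fa_scalar fa_mult\<close>)

lemma free_coset: "I +>\<^bsub>free_algebra X\<^esub> a = (\<lambda>h. h + a) ` I"
  by (auto simp: a_r_coset_def r_coset_def)

lemma ai_coset_eq: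
  "(alg_ideal X S +>\<^bsub>free_algebra X\<^esub> a = alg_ideal X S +>\<^bsub>free_algebra X\<^esub> b)
     \<longleftrightarrow> a - b \<in> alg_ideal X S"
proof
  assume "alg_ideal X S +>\<^bsub>free_algebra X\<^esub> a = alg_ideal X S +>\<^bsub>free_algebra X\<^esub> b"
  moreover have "a \<in> alg_ideal X S +>\<^bsub>free_algebra X\<^esub> a"
    using alg_ideal.zero[of X S] by (force simp: free_coset)
  ultimately show "a - b \<in> alg_ideal X S" by (auto simp: free_coset)
next
  assume ab: "a - b \<in> alg_ideal X S"
  have "(\<lambda>h. h + a) ` alg_ideal X S \<subseteq> (\<lambda>h. h + b) ` alg_ideal X S"
  proof clarify
    fix h assume "h \<in> alg_ideal X S"
    then have "h + (a - b) \<in> alg_ideal X S" using ab by (rule alg_ideal.add)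
    moreover have "h + a = (h + (a - b)) + b" by simp
    ultimately show "h + a \<in> (\<lambda>h. h + b) ` alg_ideal X S" by (rule rev_image_eqI)
  qed
  moreover have "(\<lambda>h. h + b) ` alg_ideal X S \<subseteq> (\<lambda>h. h + a) ` alg_ideal X S"
  proof clarify
    fix h assume "h \<in> alg_ideal X S"
    then have "h - (a - b) \<in> alg_ideal X S" using ab by (rule ai_diff)
    moreover have "h + b = (h - (a - b)) + a" by simp
    ultimately show "h + b \<in> (\<lambda>h. h + a) ` alg_ideal X S" by (rule rev_image_eqI)
  qed
  ultimately show "alg_ideal X S +>\<^bsub>free_algebra X\<^esub> a = alg_ideal X S +>\<^bsub>free_algebra X\<^esub> b"
    by (auto simp: free_coset)
qed

lemma ai_coset_add:
  "set_add (free_algebra X) (alg_ideal X S +>\<^bsub>free_algebra X\<^esub> a) (alg_ideal X S +>\<^bsub>free_algebra X\<^esub> b)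
    = alg_ideal X S +>\<^bsub>free_algebra X\<^esub> (a + b)"
proof -
  have "(\<exists>h\<in>alg_ideal X S. \<exists>k\<in>alg_ideal X S. x = h + a + (k + b)) \<longleftrightarrow>
        (\<exists>h\<in>alg_ideal X S. x = h + (a + b))" for x
  proof
    assume "\<exists>h\<in>alg_ideal X S. \<exists>k\<in>alg_ideal X S. x = h + a + (k + b)"
    then obtain h k where "h \<in> alg_ideal X S" "k \<in> alg_ideal X S" "x = h + a + (k + b)" by blast
    then show "\<exists>h\<in>alg_ideal X S. x = h + (a + b)"
      by (intro bexI[of _ "h + k"]) (auto intro: alg_ideal.add simp: algebra_simps)
  next
    assume "\<exists>h\<in>alg_ideal X S. x = h + (a + b)"
    then obtain h where "h \<in> alg_ideal X S" "x = h + (a + b)" by blast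
    then show "\<exists>h\<in>alg_ideal X S. \<exists>k\<in>alg_ideal X S. x = h + a + (k + b)"
      by (intro bexI[of _ h] bexI[of _ 0]) (auto intro: alg_ideal.zero simp: algebra_simps)
  qed
  note mem = this
  have sa: "set_add (free_algebra X) A B = {x. \<exists>p\<in>A. \<exists>q\<in>B. x = p + q}" for A B
    by (auto simp: set_add_def set_mult_def)
  show ?thesis
    unfolding sa free_coset
  proof (rule Set.set_eqI)
    fix x
    show "x \<in> {x. \<exists>p\<in>(\<lambda>h. h + a) ` alg_ideal X S. \<exists>q\<in>(\<lambda>h. h + b) ` alg_ideal X S. x = p + q}
      \<longleftrightarrow> x \<in> (\<lambda>h. h + (a + b)) ` alg_ideal X S"
      using mem[of x] by (simp only: image_iff mem_Collect_eq bex_simps)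
  qed
qed

lemma ai_coset_mult:
  assumes S: "S \<subseteq> carrier (free_algebra X)"
    and a: "a \<in> carrier (free_algebra X)" and b: "b \<in> carrier (free_algebra X)"
  shows "rcoset_mult (free_algebra X) (alg_ideal X S)
      (alg_ideal X S +>\<^bsub>free_algebra X\<^esub> a) (alg_ideal X S +>\<^bsub>free_algebra X\<^esub> b)
    = alg_ideal X S +>\<^bsub>free_algebra X\<^esub> (a * b)"
proof -
  let ?I = "alg_ideal X S"
  let ?c = "\<lambda>x. ?I +>\<^bsub>free_algebra X\<^esub> x"
  have eq: "?c (x * y) = ?c (a * b)" if "x \<in> ?c a" "y \<in> ?c b" for x y
  proof -
    from that obtain h k where h: "h \<in> ?I" "x = h + a" and k: "k \<in> ?I" "y = k + b"
      by (auto simp: free_coset)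
    have "x * y - a * b = h * (k + b) + a * k" by (simp add: h k algebra_simps)
    also have "\<dots> \<in> ?I"
      using h k a b ai_subset[OF S] by (intro alg_ideal.add alg_ideal.right alg_ideal.left fa_add)
    finally show ?thesis by (simp add: ai_coset_eq)
  qed
  have mem: "x \<in> ?c x" for x using alg_ideal.zero[of X S] by (force simp: free_coset)
  have ne: "?c x \<noteq> {}" for x using mem[of x] by blast
  have "(\<Union>x\<in>?c a. \<Union>y\<in>?c b. ?c (x * y)) = (\<Union>x\<in>?c a. \<Union>y\<in>?c b. ?c (a * b))"
    by (intro SUP_cong refl eq)
  also have "\<dots> = ?c (a * b)"
    by (simp only: UN_constant ne if_False)
  finally show ?thesis
    unfolding rcoset_mult_def free_algebra_simps .
qed

lemma gen_in_cohn:
  "v \<in> verts E \<Longrightarrow> gen (Vert v) \<in> carrier (free_algebra (cohn_gens E))"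
  "e \<in> arcs E \<Longrightarrow> gen (Edge e) \<in> carrier (free_algebra (cohn_gens E))"
  "e \<in> arcs E \<Longrightarrow> gen (Ghost e) \<in> carrier (free_algebra (cohn_gens E))"
  by (auto intro!: fa_gen simp: cohn_gens_def)

lemma cohn_relations_subset:
  assumes "wf_digraph E"
  shows "cohn_relations E \<subseteq> carrier (free_algebra (cohn_gens E))"
proof -
  interpret wf_digraph E by fact
  show ?thesis
    unfolding cohn_relations_def
    by (auto intro!: fa_diff fa_mult gen_in_cohn fa_zero fa_uminus)
qed

lemma cohn_vert_vert:
  assumes "v \<in> verts E" "w \<in> verts E"
  shows "gen (Vert v) * gen (Vert w) - (if v = w then gen (Vert w) else 0) \<in> cohn_ideal E"
  unfolding cohn_ideal_def using assms
  by (intro alg_ideal.base) (unfold cohn_relations_def, blast)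

lemma cohn_unit_left_aux:
  fixes E :: "('a, 'b) pre_digraph" and x :: "(('a, 'b) cohn_gen, 'c::field) free_alg"
  assumes E: "fin_digraph E" and v: "v \<in> verts E"
    and x: "x \<in> carrier (free_algebra (cohn_gens E))"
    and vx: "gen (Vert v) * x - x \<in> cohn_ideal E"
  shows "(\<Sum>w\<in>verts E. gen (Vert w)) * x - x \<in> cohn_ideal E"
proof -
  interpret fin_digraph E by fact
  let ?u = "\<Sum>w\<in>verts E. gen (Vert w) :: (('a, 'b) cohn_gen, 'c) free_alg"
  have "(\<Sum>w\<in>verts E. gen (Vert w) * gen (Vert v) - (if w = v then gen (Vert v) else 0))
      \<in> (cohn_ideal E :: (('a, 'b) cohn_gen, 'c) free_alg set)"
    unfolding cohn_ideal_def
    by (rule ai_sum) (rule cohn_vert_vert[OF _ v, unfolded cohn_ideal_def])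
  then have uv: "?u * gen (Vert v) - gen (Vert v) \<in> cohn_ideal E"
    using v by (simp add: sum_subtractf sum_distrib_right)
  have u: "?u \<in> carrier (free_algebra (cohn_gens E))" by (intro fa_sum gen_in_cohn)
  have "?u * x - x = (?u * gen (Vert v) - gen (Vert v)) * x - ?u * (gen (Vert v) * x - x)
      + (gen (Vert v) * x - x)"
    by (simp add: algebra_simps)
  also have "\<dots> \<in> cohn_ideal E"
    using uv vx u x unfolding cohn_ideal_def
    by - (rule alg_ideal.add[OF ai_diff[OF alg_ideal.right alg_ideal.left]], assumption+)
  finally show ?thesis .
qed

lemma cohn_unit_right_aux:
  fixes E :: "('a, 'b) pre_digraph" and x :: "(('a, 'b) cohn_gen, 'c::field) free_alg"
  assumes E: "fin_digraph E" and v: "v \<in> verts E"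
    and x: "x \<in> carrier (free_algebra (cohn_gens E))"
    and vx: "x * gen (Vert v) - x \<in> cohn_ideal E"
  shows "x * (\<Sum>w\<in>verts E. gen (Vert w)) - x \<in> cohn_ideal E"
proof -
  interpret fin_digraph E by fact
  let ?u = "\<Sum>w\<in>verts E. gen (Vert w) :: (('a, 'b) cohn_gen, 'c) free_alg"
  have "(\<Sum>w\<in>verts E. gen (Vert v) * gen (Vert w) - (if v = w then gen (Vert w) else 0))
      \<in> (cohn_ideal E :: (('a, 'b) cohn_gen, 'c) free_alg set)"
    unfolding cohn_ideal_def
    by (rule ai_sum) (rule cohn_vert_vert[OF v, unfolded cohn_ideal_def])
  then have uv: "gen (Vert v) * ?u - gen (Vert v) \<in> cohn_ideal E"
    using v by (simp add: sum_subtractf sum_distrib_left)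
  have u: "?u \<in> carrier (free_algebra (cohn_gens E))" by (intro fa_sum gen_in_cohn)
  have "x * ?u - x = x * (gen (Vert v) * ?u - gen (Vert v)) - (x * gen (Vert v) - x) * ?u
      + (x * gen (Vert v) - x)"
    by (simp add: algebra_simps)
  also have "\<dots> \<in> cohn_ideal E"
    using uv vx u x unfolding cohn_ideal_def
    by - (rule alg_ideal.add[OF ai_diff[OF alg_ideal.left alg_ideal.right]], assumption+)
  finally show ?thesis .
qed

lemma cohn_unit_gen:
  assumes E: "fin_digraph E" and g: "g \<in> cohn_gens E"
  shows "(\<Sum>w\<in>verts E. gen (Vert w)) * gen g - gen g \<in> cohn_ideal E"
    and "gen g * (\<Sum>w\<in>verts E. gen (Vert w)) - gen g \<in> cohn_ideal E"
proof -
  interpret fin_digraph E by fact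
  have gc: "gen g \<in> carrier (free_algebra (cohn_gens E))" by (rule fa_gen[OF g])
  have "\<exists>v\<in>verts E. gen (Vert v) * gen g - gen g \<in> (cohn_ideal E :: (_, 'c) free_alg set)"
  proof (cases g)
    case (Vert v)
    then have "v \<in> verts E" using g by (auto simp: cohn_gens_def)
    then show ?thesis using cohn_vert_vert[of v E v] Vert by auto
  next
    case (Edge e)
    then have "e \<in> arcs E" using g by (auto simp: cohn_gens_def)
    then have "gen (Vert (tail E e)) * gen g - gen g \<in> (cohn_relations E :: (_, 'c) free_alg set)"
      unfolding cohn_relations_def Edge by blast
    then show ?thesis using \<open>e \<in> arcs E\<close> unfolding cohn_ideal_def by (blast intro: alg_ideal.base tail_in_verts)
  next
    case (Ghost e)
    then have "e \<in> arcs E" using g by (auto simp: cohn_gens_def)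
    then have "gen (Vert (head E e)) * gen g - gen g \<in> (cohn_relations E :: (_, 'c) free_alg set)"
      unfolding cohn_relations_def Ghost by blast
    then show ?thesis using \<open>e \<in> arcs E\<close> unfolding cohn_ideal_def by (blast intro: alg_ideal.base head_in_verts)
  qed
  then show "(\<Sum>w\<in>verts E. gen (Vert w)) * gen g - gen g \<in> (cohn_ideal E :: (_, 'c) free_alg set)"
    using cohn_unit_left_aux[OF E _ gc] by blast
  have "\<exists>v\<in>verts E. gen g * gen (Vert v) - gen g \<in> (cohn_ideal E :: (_, 'd) free_alg set)"
  proof (cases g)
    case (Vert v)
    then have "v \<in> verts E" using g by (auto simp: cohn_gens_def)
    then show ?thesis using cohn_vert_vert[of v E v] Vert by auto
  next
    case (Edge e)
    then have "e \<in> arcs E" using g by (auto simp: cohn_gens_def)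
    then have "gen g * gen (Vert (head E e)) - gen g \<in> (cohn_relations E :: (_, 'd) free_alg set)"
      unfolding cohn_relations_def Edge by blast
    then show ?thesis using \<open>e \<in> arcs E\<close> unfolding cohn_ideal_def by (blast intro: alg_ideal.base head_in_verts)
  next
    case (Ghost e)
    then have "e \<in> arcs E" using g by (auto simp: cohn_gens_def)
    then have "gen g * gen (Vert (tail E e)) - gen g \<in> (cohn_relations E :: (_, 'd) free_alg set)"
      unfolding cohn_relations_def Ghost by blast
    then show ?thesis using \<open>e \<in> arcs E\<close> unfolding cohn_ideal_def by (blast intro: alg_ideal.base tail_in_verts)
  qed
  then show "gen g * (\<Sum>w\<in>verts E. gen (Vert w)) - gen g \<in> (cohn_ideal E :: (_, 'd) free_alg set)"
    using cohn_unit_right_aux[OF E _ fa_gen[OF g]] by blast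
qed

lemma cohn_unit:
  fixes E :: "('a, 'b) pre_digraph" and a :: "(('a, 'b) cohn_gen, 'c::field) free_alg"
  assumes E: "fin_digraph E" and a: "a \<in> carrier (free_algebra (cohn_gens E))"
  shows "(\<Sum>w\<in>verts E. gen (Vert w)) * a - a \<in> cohn_ideal E"
    and "a * (\<Sum>w\<in>verts E. gen (Vert w)) - a \<in> cohn_ideal E"
proof -
  let ?u = "\<Sum>w\<in>verts E. gen (Vert w) :: (('a, 'b) cohn_gen, 'c) free_alg"
  let ?m = "\<lambda>w. Poly_Mapping.single w (Poly_Mapping.lookup a w)"
  have l: "?u * ?m w - ?m w \<in> cohn_ideal E" if w: "w \<in> Poly_Mapping.keys a" for w
  proof -
    have lw: "letters w \<noteq> []" "set (letters w) \<subseteq> cohn_gens E"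
      using w a by (auto simp: free_algebra_carrier)
    then obtain g ws where gw': "letters w = g # ws" by (cases "letters w") auto
    have "w = Word (g # ws)" using gw' by (cases w) simp
    then have gw: "w = Word (g # ws)" "g \<in> cohn_gens E" "set ws \<subseteq> cohn_gens E"
      using lw gw' by simp_all
    have "?m w = gen g * Poly_Mapping.single (Word ws) (Poly_Mapping.lookup a w)"
      by (simp add: gw gen_def mult_single plus_free_monoid_def)
    then have "?u * ?m w - ?m w = (?u * gen g - gen g) * Poly_Mapping.single (Word ws) (Poly_Mapping.lookup a w)"
      by (simp add: algebra_simps)
    then show ?thesis
      using ai_word_right[OF cohn_unit_gen(1)[OF E gw(2), unfolded cohn_ideal_def] gw(3)]
      by (simp add: cohn_ideal_def)
  qed
  have r: "?m w * ?u - ?m w \<in> cohn_ideal E" if w: "w \<in> Poly_Mapping.keys a" for w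
  proof -
    have lw: "letters w \<noteq> []" "set (letters w) \<subseteq> cohn_gens E"
      using w a by (auto simp: free_algebra_carrier)
    then obtain g ws where gw': "letters w = ws @ [g]" by (metis rev_exhaust)
    have "w = Word (ws @ [g])" using gw' by (cases w) simp
    then have gw: "w = Word (ws @ [g])" "g \<in> cohn_gens E" "set ws \<subseteq> cohn_gens E"
      using lw gw' by simp_all
    have "?m w = Poly_Mapping.single (Word ws) (Poly_Mapping.lookup a w) * gen g"
      by (simp add: gw gen_def mult_single plus_free_monoid_def)
    then have "?m w * ?u - ?m w = Poly_Mapping.single (Word ws) (Poly_Mapping.lookup a w) * (gen g * ?u - gen g)"
      by (simp add: algebra_simps)
    then show ?thesis
      using ai_word_left[OF cohn_unit_gen(2)[OF E gw(2), unfolded cohn_ideal_def] gw(3)]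
      by (simp add: cohn_ideal_def)
  qed
  have a_eq: "(\<Sum>w\<in>Poly_Mapping.keys a. ?m w) = a" by (rule poly_mapping_sum_monomials)
  have "(\<Sum>w\<in>Poly_Mapping.keys a. ?u * ?m w - ?m w) \<in> cohn_ideal E"
    unfolding cohn_ideal_def by (rule ai_sum) (rule l[unfolded cohn_ideal_def])
  then show "?u * a - a \<in> cohn_ideal E"
    by (simp only: sum_subtractf flip: sum_distrib_left) (simp only: a_eq)
  have "(\<Sum>w\<in>Poly_Mapping.keys a. ?m w * ?u - ?m w) \<in> cohn_ideal E"
    unfolding cohn_ideal_def by (rule ai_sum) (rule r[unfolded cohn_ideal_def])
  then show "a * ?u - a \<in> cohn_ideal E"
    by (simp only: sum_subtractf flip: sum_distrib_right) (simp only: a_eq)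
qed

lemma ring_cohn_path_algebra:
  assumes E: "fin_digraph E"
  shows "ring (cohn_path_algebra E :: (('v, 'e) cohn_gen, 'k::field) free_alg set ring)"
proof -
  interpret fin_digraph E by fact
  let ?F = "free_algebra (cohn_gens E) :: (('v, 'e) cohn_gen, 'k) free_alg ring"
  let ?I = "cohn_ideal E :: (('v, 'e) cohn_gen, 'k) free_alg set"
  let ?C = "cohn_path_algebra E :: (('v, 'e) cohn_gen, 'k) free_alg set ring"
  let ?u = "\<Sum>v\<in>verts E. gen (Vert v) :: (('v, 'e) cohn_gen, 'k) free_alg"
  define c where "c = (\<lambda>x. ?I +>\<^bsub>?F\<^esub> x)"
  have carr: "carrier ?C = c ` carrier ?F"
    by (auto simp: cohn_path_algebra_def FactRing_def A_RCOSETS_defs c_def a_r_coset_def r_coset_def)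
  have eq: "c a = c b \<longleftrightarrow> a - b \<in> ?I" for a b
    by (simp add: c_def cohn_ideal_def ai_coset_eq)
  have add: "c a \<oplus>\<^bsub>?C\<^esub> c b = c (a + b)" for a b
    by (simp add: cohn_path_algebra_def FactRing_def c_def cohn_ideal_def ai_coset_add)
  have mult: "c a \<otimes>\<^bsub>?C\<^esub> c b = c (a * b)" if "a \<in> carrier ?F" "b \<in> carrier ?F" for a b
    using that ai_coset_mult[OF cohn_relations_subset[OF wf_digraph]]
    by (simp add: cohn_path_algebra_def FactRing_def c_def cohn_ideal_def)
  have one: "\<one>\<^bsub>?C\<^esub> = c ?u"
    by (simp add: cohn_path_algebra_def c_def)
  have zero: "\<zero>\<^bsub>?C\<^esub> = c 0"
    by (simp add: cohn_path_algebra_def FactRing_def c_def free_coset)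
  have u: "?u \<in> carrier ?F" by (intro fa_sum gen_in_cohn)
  show ?thesis
  proof (rule ringI)
    show "abelian_group ?C"
    proof (rule abelian_groupI)
      fix x assume "x \<in> carrier ?C"
      then obtain a where a: "a \<in> carrier ?F" "x = c a" by (auto simp: carr)
      then show "\<exists>y\<in>carrier ?C. y \<oplus>\<^bsub>?C\<^esub> x = \<zero>\<^bsub>?C\<^esub>"
        by (intro bexI[of _ "c (- a)"]) (auto simp: carr add zero intro: fa_uminus)
    qed (auto simp: carr add zero add_ac intro: fa_add fa_zero)
  next
    show "monoid ?C"
    proof (rule monoidI)
      show "\<one>\<^bsub>?C\<^esub> \<in> carrier ?C" using u by (auto simp: one carr)
    next
      fix x assume "x \<in> carrier ?C"
      then obtain a where a: "a \<in> carrier ?F" "x = c a" by (auto simp: carr)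
      then show "\<one>\<^bsub>?C\<^esub> \<otimes>\<^bsub>?C\<^esub> x = x" "x \<otimes>\<^bsub>?C\<^esub> \<one>\<^bsub>?C\<^esub> = x"
        using u cohn_unit[OF E a(1)] by (simp_all add: one mult eq)
    qed (auto simp: carr mult fa_mult mult.assoc)
  qed (auto simp: carr add mult fa_mult fa_add algebra_simps)
qed

end

theory Submission
  imports Defs "HOL-Library.Function_Algebras"
begin

text \<open>
  The algebra acts on the space \<open>V\<^sub>0\<close> of functions on paths and, with the action of ghost edges
  truncated, on the space \<open>V\<^sub>1\<close> of functions on paths of length at least one. Every element of the
  algebra commutes with the restriction \<open>V\<^sub>0 \<rightarrow> V\<^sub>1\<close> up to finitely many paths, and the kernel of the
  restriction has dimension equal to the number of vertices. An invertible \<open>n \<times> m\<close> matrix \<open>A\<close> over the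
  algebra therefore yields two surjections \<open>V\<^sub>0\<^sup>m \<rightarrow> V\<^sub>1\<^sup>n\<close>, namely restriction before \<open>A\<close> and
  restriction after \<open>A\<close>, which differ by a map of finite rank and so have kernels of the same
  dimension. These dimensions are \<open>m\<close> and \<open>n\<close> times the number of vertices.
\<close>

section \<open>Dimension of preimages\<close>

definition fun_scale :: "'k::field \<Rightarrow> ('b \<Rightarrow> 'k) \<Rightarrow> ('b \<Rightarrow> 'k)"
  where "fun_scale c f = (\<lambda>x. c * f x)"

interpretation fun_vs: vector_space fun_scale
  by unfold_locales (auto simp: fun_scale_def fun_eq_iff algebra_simps)

text \<open>This is a predicate rather than a number so that finite dimension is part of the
  assertion. The spaces of functions on paths may well be infinite-dimensional.\<close>

definition has_dim :: "('b \<Rightarrow> 'k::field) set \<Rightarrow> nat \<Rightarrow> bool"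
  where "has_dim W k \<longleftrightarrow>
    (\<exists>B. finite B \<and> fun_vs.independent B \<and> fun_vs.span B = W \<and> card B = k)"

lemma has_dim_unique: "has_dim W k \<Longrightarrow> has_dim W l \<Longrightarrow> k = l"
  unfolding has_dim_def by (metis fun_vs.dim_span_eq_card_independent)

lemma has_dim_zero: "has_dim {0} 0"
  unfolding has_dim_def by (intro exI[of _ "{}"]) (simp add: fun_vs.independent_empty)

text \<open>Rank-nullity for \<open>F\<close> on the preimage of \<open>Z\<close>: a basis of the
  kernel together with lifts of a basis of \<open>Z\<close> is a basis of the preimage. Only kernel
  and target are finite-dimensional; \<open>X\<close> may be infinite-dimensional.\<close>

lemma has_dim_vimage:
  assumes F: "Vector_Spaces.linear fun_scale fun_scale F" and X: "fun_vs.subspace X" and ZX: "Z \<subseteq> F ` X"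
    and K: "has_dim {x \<in> X. F x = 0} k" and Z: "has_dim Z l"
  shows "has_dim {x \<in> X. F x \<in> Z} (k + l)"
proof -
  interpret F: Vector_Spaces.linear fun_scale fun_scale F by (rule F)
  obtain B where B: "finite B" "fun_vs.independent B" "fun_vs.span B = {x \<in> X. F x = 0}" "card B = k"
    using K unfolding has_dim_def by blast
  obtain C where C: "finite C" "fun_vs.independent C" "fun_vs.span C = Z" "card C = l"
    using Z unfolding has_dim_def by blast
  have "\<forall>c\<in>C. \<exists>x\<in>X. F x = c"
    using ZX C(3) fun_vs.span_superset[of C] by blast
  then obtain g where g: "\<And>c. c \<in> C \<Longrightarrow> g c \<in> X" "\<And>c. c \<in> C \<Longrightarrow> F (g c) = c"
    by metis
  have inj: "inj_on g C" by (rule inj_onI) (metis g(2))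
  have C0: "0 \<notin> C" using C(2) fun_vs.dependent_zero by blast
  have BK: "b \<in> X" "F b = 0" if "b \<in> B" for b
    using that B(3) fun_vs.span_base[of b B] by auto
  have disj: "B \<inter> g ` C = {}"
  proof (rule Int_emptyI, elim imageE)
    fix x c assume "x \<in> B" "x = g c" "c \<in> C"
    then have "c = 0" using BK(2)[of x] g(2)[of c] by simp
    then show False using C0 \<open>c \<in> C\<close> by simp
  qed
  have indep: "fun_vs.independent (B \<union> g ` C)"
  proof (rule fun_vs.independent_if_scalars_zero)
    show "finite (B \<union> g ` C)" using B C by simp
    fix u x assume *: "(\<Sum>x\<in>B \<union> g ` C. fun_scale (u x) x) = 0" and x: "x \<in> B \<union> g ` C"
    have split: "(\<Sum>x\<in>B. fun_scale (u x) x) + (\<Sum>c\<in>C. fun_scale (u (g c)) (g c)) = 0"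
      using * B C disj by (simp add: sum.union_disjoint sum.reindex[OF inj])
    \<comment> \<open>\<open>F\<close> kills the elements of \<open>B\<close>, so a linear relation
      between the lifts becomes one on the basis \<open>C\<close>.\<close>
    then have "0 = F ((\<Sum>x\<in>B. fun_scale (u x) x) + (\<Sum>c\<in>C. fun_scale (u (g c)) (g c)))"
      by simp
    also have "\<dots> = (\<Sum>c\<in>C. fun_scale (u (g c)) c)"
      using BK g by (simp add: F.add F.sum F.scale)
    finally have "(\<Sum>c\<in>C. fun_scale (u (g c)) c) = 0" by simp
    then have uC: "u (g c) = 0" if "c \<in> C" for c
      using fun_vs.independentD[OF C(2,1) order_refl, of "\<lambda>c. u (g c)"] that by blast
    then have "(\<Sum>x\<in>B. fun_scale (u x) x) = 0" using split by simp
    then have "u b = 0" if "b \<in> B" for b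
      using fun_vs.independentD[OF B(2,1) order_refl, of u] that by blast
    then show "u x = 0" using x uC by blast
  qed
  have Zsub: "fun_vs.subspace Z" using C(3) fun_vs.subspace_span[of C] by simp
  have sub: "fun_vs.subspace {x \<in> X. F x \<in> Z}"
    using X Zsub by (auto simp: fun_vs.subspace_def F.add F.scale)
  have "fun_vs.span (B \<union> g ` C) = {x \<in> X. F x \<in> Z}"
  proof
    have "B \<union> g ` C \<subseteq> {x \<in> X. F x \<in> Z}"
      using BK g C(3) fun_vs.span_superset[of C] fun_vs.subspace_0[OF Zsub] by auto
    then show "fun_vs.span (B \<union> g ` C) \<subseteq> {x \<in> X. F x \<in> Z}"
      using sub by (rule fun_vs.span_minimal)
    show "{x \<in> X. F x \<in> Z} \<subseteq> fun_vs.span (B \<union> g ` C)"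
    proof clarify
      fix x assume x: "x \<in> X" "F x \<in> Z"
      then obtain u where u: "F x = (\<Sum>c\<in>C. fun_scale (u c) c)"
        using C(1,3) fun_vs.span_finite[of C] by auto
      \<comment> \<open>\<open>?y\<close> is a preimage of \<open>F x\<close> in the span of the
        lifts, so \<open>x - ?y\<close> lies in the kernel, which is spanned by
        \<open>B\<close>.\<close>
      let ?y = "\<Sum>c\<in>C. fun_scale (u c) (g c)"
      have "F (x - ?y) = 0" using u g by (simp add: F.diff F.sum F.scale)
      moreover have "?y \<in> X" using g by (intro fun_vs.subspace_sum[OF X] fun_vs.subspace_scale[OF X])
      ultimately have "x - ?y \<in> fun_vs.span B" using x B(3) fun_vs.subspace_diff[OF X] by auto
      then have "x - ?y \<in> fun_vs.span (B \<union> g ` C)" using fun_vs.span_mono[of B "B \<union> g ` C"] by blast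
      moreover have "?y \<in> fun_vs.span (B \<union> g ` C)"
        by (intro fun_vs.span_sum fun_vs.span_scale fun_vs.span_base) auto
      ultimately have "x - ?y + ?y \<in> fun_vs.span (B \<union> g ` C)" by (rule fun_vs.span_add)
      then show "x \<in> fun_vs.span (B \<union> g ` C)" by simp
    qed
  qed
  moreover have "card (B \<union> g ` C) = k + l"
    using B C disj by (simp add: card_Un_disjoint card_image[OF inj])
  ultimately show ?thesis
    unfolding has_dim_def using indep B(1) C(1) by (intro exI[of _ "B \<union> g ` C"]) simp
qed

text \<open>Functions on \<open>Q\<close> are extended by zero, so that the spaces for different
  \<open>Q\<close> are subspaces of one vector space.\<close>

definition funs_on :: "'b set \<Rightarrow> ('b \<Rightarrow> 'k::zero) set"
  where "funs_on Q = {f. \<forall>x. x \<notin> Q \<longrightarrow> f x = 0}"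

lemma funs_onD: "f \<in> funs_on Q \<Longrightarrow> x \<notin> Q \<Longrightarrow> f x = 0"
  by (simp add: funs_on_def)

lemma subspace_funs_on: "fun_vs.subspace (funs_on Q)"
  by (auto simp: fun_vs.subspace_def funs_on_def fun_scale_def)

lemma sum_fun_apply: "(\<Sum>i\<in>A. f i) x = (\<Sum>i\<in>A. f i x)"
  by (induction A rule: infinite_finite_induct) auto

text \<open>The indicator functions of the points of \<open>Q\<close> form a basis.\<close>

lemma has_dim_funs_on:
  assumes "finite Q"
  shows "has_dim (funs_on Q :: ('b \<Rightarrow> 'k::field) set) (card Q)"
proof -
  let ?d = "\<lambda>q x. if x = q then 1 else 0 :: 'k"
  have inj: "inj_on ?d Q" by (rule inj_onI) (metis zero_neq_one)
  have comb: "(\<Sum>f\<in>?d ` Q. fun_scale (u f) f) = (\<lambda>x. if x \<in> Q then u (?d x) else 0)" for u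
    using assms by (auto simp: fun_eq_iff sum_fun_apply sum.reindex[OF inj] fun_scale_def
        if_distrib[of "\<lambda>y. _ * y"] cong: if_cong)
  have "fun_vs.independent (?d ` Q)"
  proof (rule fun_vs.independent_if_scalars_zero)
    show "finite (?d ` Q)" using assms by simp
    fix u f assume "(\<Sum>f\<in>?d ` Q. fun_scale (u f) f) = 0" "f \<in> ?d ` Q"
    then show "u f = 0" unfolding comb by (auto dest: fun_cong split: if_splits)
  qed
  moreover have "fun_vs.span (?d ` Q) = funs_on Q"
  proof
    show "fun_vs.span (?d ` Q) \<subseteq> funs_on Q"
      by (rule fun_vs.span_minimal[OF _ subspace_funs_on]) (auto simp: funs_on_def)
    show "funs_on Q \<subseteq> fun_vs.span (?d ` Q)"
    proof
      fix f :: "'b \<Rightarrow> 'k" assume "f \<in> funs_on Q"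
      then have "f = (\<Sum>q\<in>Q. fun_scale (f q) (?d q))"
        using assms by (auto simp: fun_eq_iff sum_fun_apply fun_scale_def funs_on_def
            if_distrib[of "\<lambda>y. _ * y"] cong: if_cong)
      also have "\<dots> \<in> fun_vs.span (?d ` Q)"
        by (intro fun_vs.span_sum fun_vs.span_scale fun_vs.span_base) auto
      finally show "f \<in> fun_vs.span (?d ` Q)" .
    qed
  qed
  ultimately show ?thesis
    unfolding has_dim_def using assms card_image[OF inj] by (intro exI[of _ "?d ` Q"]) simp
qed

section \<open>Isomorphisms of free modules as matrices\<close>

lemma right_module_iso_inv:
  assumes R: "ring R" and iso: "right_module_iso R m n \<phi>"
  shows "right_module_iso R n m (inv_into (power_carrier R m) \<phi>)"
proof -
  interpret ring R by fact
  let ?M = "power_carrier R m" and ?N = "power_carrier R n"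
  let ?\<psi> = "inv_into ?M \<phi>"
  have bij: "bij_betw \<phi> ?M ?N"
    and add: "\<And>x y. x \<in> ?M \<Longrightarrow> y \<in> ?M \<Longrightarrow> \<phi> (power_add R m x y) = power_add R n (\<phi> x) (\<phi> y)"
    and smult: "\<And>x r. x \<in> ?M \<Longrightarrow> r \<in> carrier R \<Longrightarrow> \<phi> (power_rsmult R m x r) = power_rsmult R n (\<phi> x) r"
    using iso by (auto simp: right_module_iso_def)
  have mem: "?\<psi> x \<in> ?M" "\<phi> (?\<psi> x) = x" if "x \<in> ?N" for x
    using bij that by (auto simp: bij_betw_def f_inv_into_f inv_into_into)
  have addM: "power_add R m x y \<in> ?M" if "x \<in> ?M" "y \<in> ?M" for x y
    using that by (auto simp: power_add_def power_carrier_def PiE_mem)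
  have smultM: "power_rsmult R m x r \<in> ?M" if "x \<in> ?M" "r \<in> carrier R" for x r
    using that by (auto simp: power_rsmult_def power_carrier_def PiE_mem)
  have eqI: "?\<psi> y = x" if "x \<in> ?M" "\<phi> x = y" for x y
    using that bij by (auto simp: bij_betw_def)
  show ?thesis
    unfolding right_module_iso_def
  proof (intro conjI ballI)
    show "bij_betw ?\<psi> ?N ?M" using bij by (rule bij_betw_inv_into)
    show "?\<psi> (power_add R n x y) = power_add R m (?\<psi> x) (?\<psi> y)" if "x \<in> ?N" "y \<in> ?N" for x y
      using that by (intro eqI addM mem) (simp_all add: add mem)
    show "?\<psi> (power_rsmult R n x r) = power_rsmult R m (?\<psi> x) r" if "x \<in> ?N" "r \<in> carrier R" for x r
      using that by (intro eqI smultM mem) (simp_all add: smult mem)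
  qed
qed

definition unit_vec :: "('a, 'b) ring_scheme \<Rightarrow> nat \<Rightarrow> nat \<Rightarrow> (nat \<Rightarrow> 'a)"
  where "unit_vec R m j = (\<lambda>i\<in>{..<m}. if i = j then \<one>\<^bsub>R\<^esub> else \<zero>\<^bsub>R\<^esub>)"

lemma unit_vec_carrier: "ring R \<Longrightarrow> unit_vec R m j \<in> power_carrier R m"
  by (auto simp: unit_vec_def power_carrier_def ring.ring_simprules)

text \<open>A right-linear map is left multiplication by the matrix whose columns are the images of
  the unit vectors.\<close>

lemma right_module_iso_apply:
  assumes R: "ring R" and iso: "right_module_iso R m n \<phi>"
    and x: "x \<in> power_carrier R m" and i: "i < n"
  shows "\<phi> x i = finsum R (\<lambda>j. \<phi> (unit_vec R m j) i \<otimes>\<^bsub>R\<^esub> x j) {..<m}"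
proof -
  interpret ring R by fact
  let ?M = "power_carrier R m" and ?N = "power_carrier R n"
  have bij: "bij_betw \<phi> ?M ?N"
    and add: "\<And>x y. x \<in> ?M \<Longrightarrow> y \<in> ?M \<Longrightarrow> \<phi> (power_add R m x y) = power_add R n (\<phi> x) (\<phi> y)"
    and smult: "\<And>x r. x \<in> ?M \<Longrightarrow> r \<in> carrier R \<Longrightarrow> \<phi> (power_rsmult R m x r) = power_rsmult R n (\<phi> x) r"
    using iso by (auto simp: right_module_iso_def)
  have \<phi>: "\<phi> y i \<in> carrier R" if "y \<in> ?M" for y
    using bij that i by (auto simp: bij_betw_def power_carrier_def PiE_mem)
  have xc: "x j \<in> carrier R" if "j < m" for j
    using x that by (auto simp: power_carrier_def PiE_mem)
  \<comment> \<open>\<open>tr k\<close> keeps the first \<open>k\<close> coordinates of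
    \<open>x\<close>, so each step of the induction adds one multiple of a unit vector.\<close>
  define tr where "tr k = (\<lambda>j\<in>{..<m}. if j < k then x j else \<zero>\<^bsub>R\<^esub>)" for k
  have trM: "tr k \<in> ?M" for k
    using xc by (auto simp: tr_def power_carrier_def)
  have "\<phi> (tr k) i = finsum R (\<lambda>j. \<phi> (unit_vec R m j) i \<otimes>\<^bsub>R\<^esub> x j) {..<k}" if "k \<le> m" for k
    using that
  proof (induction k)
    case 0
    \<comment> \<open>The zero vector is its own multiple by the scalar 0, so compatibility with
      scalars already sends it to zero.\<close>
    have "tr 0 = power_rsmult R m (tr 0) \<zero>\<^bsub>R\<^esub>"
      by (auto simp: tr_def power_rsmult_def)
    then have "\<phi> (tr 0) i = power_rsmult R n (\<phi> (tr 0)) \<zero>\<^bsub>R\<^esub> i"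
      using smult[OF trM[of 0] zero_closed] by simp
    also have "\<dots> = \<zero>\<^bsub>R\<^esub>" using i \<phi>[OF trM] by (simp add: power_rsmult_def)
    finally show ?case by simp
  next
    case (Suc k)
    have k: "k < m" using Suc by simp
    have uM: "power_rsmult R m (unit_vec R m k) (x k) \<in> ?M"
      using xc[OF k] by (auto simp: power_rsmult_def unit_vec_def power_carrier_def)
    have "tr (Suc k) = power_add R m (tr k) (power_rsmult R m (unit_vec R m k) (x k))"
      using xc k by (auto simp: tr_def power_add_def power_rsmult_def unit_vec_def less_Suc_eq)
    then have "\<phi> (tr (Suc k)) i = \<phi> (tr k) i \<oplus>\<^bsub>R\<^esub> \<phi> (unit_vec R m k) i \<otimes>\<^bsub>R\<^esub> x k"
      using i add[OF trM uM] smult[OF unit_vec_carrier[OF R] xc[OF k]]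
      by (simp add: power_add_def power_rsmult_def)
    also have "\<dots> = finsum R (\<lambda>j. \<phi> (unit_vec R m j) i \<otimes>\<^bsub>R\<^esub> x j) {..<Suc k}"
      using Suc \<phi>[OF unit_vec_carrier[OF R]] xc
      by (simp add: lessThan_Suc Pi_def add.m_comm)
    finally show ?case .
  qed
  moreover have "tr m = x"
    using x by (auto simp: tr_def power_carrier_def PiE_def extensional_def fun_eq_iff)
  ultimately show ?thesis by force
qed

text \<open>The matrices represent the isomorphism and its inverse. The two identities are the
  components of both compositions evaluated at unit vectors.\<close>

lemma right_module_iso_matrices:
  assumes R: "ring R" and iso: "right_module_iso R m n \<phi>"
  obtains a b where
    "\<And>i j. i < n \<Longrightarrow> j < m \<Longrightarrow> a i j \<in> carrier R" "\<And>i j. i < m \<Longrightarrow> j < n \<Longrightarrow> b i j \<in> carrier R"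
    "\<And>i k. i < n \<Longrightarrow> k < n \<Longrightarrow>
      finsum R (\<lambda>j. a i j \<otimes>\<^bsub>R\<^esub> b j k) {..<m} = (if i = k then \<one>\<^bsub>R\<^esub> else \<zero>\<^bsub>R\<^esub>)"
    "\<And>i k. i < m \<Longrightarrow> k < m \<Longrightarrow>
      finsum R (\<lambda>j. b i j \<otimes>\<^bsub>R\<^esub> a j k) {..<n} = (if i = k then \<one>\<^bsub>R\<^esub> else \<zero>\<^bsub>R\<^esub>)"
proof -
  let ?M = "power_carrier R m" and ?N = "power_carrier R n"
  define \<psi> where "\<psi> = inv_into ?M \<phi>"
  have iso': "right_module_iso R n m \<psi>"
    unfolding \<psi>_def using R iso by (rule right_module_iso_inv)
  have bij: "bij_betw \<phi> ?M ?N" "bij_betw \<psi> ?N ?M"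
    using iso iso' by (auto simp: right_module_iso_def)
  have \<phi>: "\<phi> (unit_vec R m j) \<in> ?N" for j
    using bij(1) unit_vec_carrier[OF R] by (auto simp: bij_betw_def)
  have \<psi>: "\<psi> (unit_vec R n j) \<in> ?M" for j
    using bij(2) unit_vec_carrier[OF R] by (auto simp: bij_betw_def)
  have inv: "\<phi> (\<psi> x) = x" if "x \<in> ?N" for x
    using bij(1) that by (auto simp: bij_betw_def \<psi>_def f_inv_into_f)
  have inv': "\<psi> (\<phi> x) = x" if "x \<in> ?M" for x
    using bij(1) that by (auto simp: bij_betw_def \<psi>_def)
  show thesis
  proof (rule that[of "\<lambda>i j. \<phi> (unit_vec R m j) i" "\<lambda>i j. \<psi> (unit_vec R n j) i"])
    show "\<phi> (unit_vec R m j) i \<in> carrier R" if "i < n" for i j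
      using \<phi>[of j] that by (auto simp: power_carrier_def PiE_mem)
    show "\<psi> (unit_vec R n j) i \<in> carrier R" if "i < m" for i j
      using \<psi>[of j] that by (auto simp: power_carrier_def PiE_mem)
    show "finsum R (\<lambda>j. \<phi> (unit_vec R m j) i \<otimes>\<^bsub>R\<^esub> \<psi> (unit_vec R n k) j) {..<m}
        = (if i = k then \<one>\<^bsub>R\<^esub> else \<zero>\<^bsub>R\<^esub>)" if "i < n" for i k
      using right_module_iso_apply[OF R iso \<psi> that, of k] inv[OF unit_vec_carrier[OF R]] that
      by (simp add: unit_vec_def)
    show "finsum R (\<lambda>j. \<psi> (unit_vec R n j) i \<otimes>\<^bsub>R\<^esub> \<phi> (unit_vec R m k) j) {..<n}
        = (if i = k then \<one>\<^bsub>R\<^esub> else \<zero>\<^bsub>R\<^esub>)" if "i < m" for i k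
      using right_module_iso_apply[OF R iso' \<phi> that, of k] inv'[OF unit_vec_carrier[OF R]] that
      by (simp add: unit_vec_def)
  qed
qed

section \<open>Representations on functions of paths\<close>

text \<open>A path is encoded as its list of edges together with its final vertex. Composability of the
  edges is never needed and not imposed: only the source has to be a vertex, so that the sum of all
  vertices acts as the identity.\<close>

definition src :: "('v, 'e) pre_digraph \<Rightarrow> 'e list \<times> 'v \<Rightarrow> 'v"
  where "src E p = (case fst p of [] \<Rightarrow> snd p | e # _ \<Rightarrow> tail E e)"

lemma src_simps [simp]: "src E ([], w) = w" "src E (e # es, w) = tail E e"
  by (simp_all add: src_def)

definition paths :: "('v, 'e) pre_digraph \<Rightarrow> nat \<Rightarrow> ('e list \<times> 'v) set"
  where "paths E t = {p. src E p \<in> verts E \<and> t \<le> length (fst p)}"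

text \<open>On indicator functions this is left multiplication of paths: a vertex projects to the
  paths that start there, an edge \<open>e\<close> is prepended to paths starting at
  \<open>head E e\<close>, and its ghost removes a leading \<open>e\<close>.\<close>

fun gen_val :: "('v, 'e) pre_digraph \<Rightarrow> ('v, 'e) cohn_gen \<Rightarrow> ('e list \<times> 'v \<Rightarrow> 'k)
    \<Rightarrow> 'e list \<times> 'v \<Rightarrow> 'k::field" where
  "gen_val E (Vert v) f p = (if src E p = v then f p else 0)"
| "gen_val E (Edge e) f ([], w) = 0"
| "gen_val E (Edge e) f (e' # es, w) =
    (if e' = e \<and> src E (es, w) = head E e then f (es, w) else 0)"
| "gen_val E (Ghost e) f (es, w) = (if src E (es, w) = head E e then f (e # es, w) else 0)"

text \<open>Restricting to paths of length at least t matters for ghost edges only.\<close>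

definition gen_act :: "('v, 'e) pre_digraph \<Rightarrow> nat \<Rightarrow> ('v, 'e) cohn_gen
    \<Rightarrow> ('e list \<times> 'v \<Rightarrow> 'k) \<Rightarrow> ('e list \<times> 'v \<Rightarrow> 'k::field)"
  where "gen_act E t g f = (\<lambda>p. if p \<in> paths E t then gen_val E g f p else 0)"

text \<open>The extension of \<open>gen_act\<close> to the free algebra given by its universal
  property. The rightmost letter acts first and the empty word acts as the identity.\<close>

definition act :: "('v, 'e) pre_digraph \<Rightarrow> nat \<Rightarrow> (('v, 'e) cohn_gen, 'k) free_alg
    \<Rightarrow> ('e list \<times> 'v \<Rightarrow> 'k) \<Rightarrow> ('e list \<times> 'v \<Rightarrow> 'k::field)"
  where "act E t a f = (\<Sum>w\<in>Poly_Mapping.keys a.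
    fun_scale (Poly_Mapping.lookup a w) (foldr (gen_act E t) (letters w) f))"

section \<open>Linearity and multiplicativity of the action\<close>

lemma fun_linearI:
  assumes "\<And>f g. F (f + g) = F f + F g" "\<And>c f. F (fun_scale c f) = fun_scale c (F f)"
  shows "Vector_Spaces.linear fun_scale fun_scale F"
  by unfold_locales (use assms in auto)

lemma linear_gen_act: "Vector_Spaces.linear fun_scale fun_scale (gen_act E t g)"
proof -
  have "gen_val E g (f + h) p = gen_val E g f p + gen_val E g h p"
    "gen_val E g (fun_scale c f) p = c * gen_val E g f p" for c :: 'a and f h p
    by (cases "(E, g, f, p)" rule: gen_val.cases; simp add: fun_scale_def)+
  then show ?thesis
    by (intro fun_linearI) (auto simp: gen_act_def fun_eq_iff fun_scale_def)
qed

lemma linear_word_act: "Vector_Spaces.linear fun_scale fun_scale (foldr (gen_act E t) ws)"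
proof (induction ws)
  case Nil
  show ?case by (intro fun_linearI) (simp_all add: fun_eq_iff)
next
  case (Cons g ws)
  then show ?case
    using Vector_Spaces.linear_compose[OF Cons linear_gen_act] by (simp add: o_def)
qed

lemma linear_act: "Vector_Spaces.linear fun_scale fun_scale (act E t a)"
proof -
  interpret W: Vector_Spaces.linear fun_scale fun_scale "foldr (gen_act E t) (letters w)" for w
    by (rule linear_word_act)
  show ?thesis
    by (intro fun_linearI)
      (simp_all add: act_def W.add W.scale fun_vs.scale_right_distrib sum.distrib
        fun_vs.scale_sum_right mult.commute)
qed

lemma act_fun_zero: "act E t a 0 = 0"
proof -
  interpret Vector_Spaces.linear fun_scale fun_scale "act E t a" by (rule linear_act)
  show ?thesis by (rule zero)
qed

text \<open>This allows the sums for two elements to run over a common index set.\<close>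

lemma act_superset:
  assumes "finite A" "Poly_Mapping.keys a \<subseteq> A"
  shows "act E t a f = (\<Sum>w\<in>A.
    fun_scale (Poly_Mapping.lookup a w) (foldr (gen_act E t) (letters w) f))"
  unfolding act_def using assms
  by (intro sum.mono_neutral_left) (auto simp: in_keys_iff)

lemma act_zero [simp]: "act E t 0 f = 0"
  by (simp add: act_def)

lemma act_single:
  "act E t (Poly_Mapping.single w c) f = fun_scale c (foldr (gen_act E t) (letters w) f)"
  by (subst act_superset[of "{w}"]) auto

lemma act_gen: "act E t (gen g) f = gen_act E t g f"
  by (simp add: gen_def act_single)

lemma act_add: "act E t (a + b) f = act E t a f + act E t b f"
proof -
  let ?A = "Poly_Mapping.keys a \<union> Poly_Mapping.keys b"
  have "Poly_Mapping.keys (a + b) \<subseteq> ?A" by (rule keys_add)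
  then show ?thesis
    by (simp add: act_superset[of ?A] lookup_add fun_vs.scale_left_distrib sum.distrib)
qed

lemma act_diff: "act E t (a - b) f = act E t a f - act E t b f"
  using act_add[of E t "a - b" b f] by simp

lemma act_sum: "act E t (\<Sum>i\<in>I. a i) f = (\<Sum>i\<in>I. act E t (a i) f)"
  by (induction I rule: infinite_finite_induct) (auto simp: act_add)

text \<open>Both factors are expanded into monomials, for which concatenation of words is
  composition of operators.\<close>

lemma act_mult: "act E t (a * b) f = act E t a (act E t b f)"
proof -
  interpret W: Vector_Spaces.linear fun_scale fun_scale "foldr (gen_act E t) (letters w)" for w
    by (rule linear_word_act)
  let ?m = "\<lambda>a w. Poly_Mapping.single w (Poly_Mapping.lookup a w)"
  have "a * b = (\<Sum>u\<in>Poly_Mapping.keys a. ?m a u) * (\<Sum>v\<in>Poly_Mapping.keys b. ?m b v)"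
    by (simp add: poly_mapping_sum_monomials)
  also have "\<dots> = (\<Sum>u\<in>Poly_Mapping.keys a. \<Sum>v\<in>Poly_Mapping.keys b.
      Poly_Mapping.single (u + v) (Poly_Mapping.lookup a u * Poly_Mapping.lookup b v))"
    by (simp add: sum_product mult_single)
  finally have ab: "a * b = \<dots>" .
  show ?thesis
    unfolding ab
    by (simp add: act_sum act_single act_def[of E t a] act_def[of E t b] W.sum W.scale
        fun_vs.scale_sum_right)
qed

section \<open>The vertex sum and the defining relations\<close>

lemma gen_act_in: "gen_act E t g f \<in> funs_on (paths E t)"
  by (simp add: gen_act_def funs_on_def)

text \<open>A nonempty word ends in a truncation by \<open>gen_act\<close>. The assumption on
  \<open>f\<close> covers the empty word.\<close>

lemma act_in:
  assumes "f \<in> funs_on (paths E t)"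
  shows "act E t a f \<in> funs_on (paths E t)"
proof -
  have "foldr (gen_act E t) ws f \<in> funs_on (paths E t)" for ws
    using assms gen_act_in by (cases ws) auto
  then show ?thesis
    unfolding act_def by (intro fun_vs.subspace_sum fun_vs.subspace_scale subspace_funs_on)
qed

text \<open>Each path in \<open>paths E t\<close> has exactly one source and it is a vertex, so
  exactly one of the projections keeps its value.\<close>

lemma act_unit:
  assumes "finite (verts E)" "f \<in> funs_on (paths E t)"
  shows "act E t (\<Sum>v\<in>verts E. gen (Vert v)) f = f"
proof
  fix p
  show "act E t (\<Sum>v\<in>verts E. gen (Vert v)) f p = f p"
  proof (cases "p \<in> paths E t")
    case True
    then have "src E p \<in> verts E" by (simp add: paths_def)
    then show ?thesis
      using True assms(1) by (simp add: act_sum act_gen sum_fun_apply gen_act_def)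
  next
    case False
    then show ?thesis
      using funs_onD[OF assms(2)] funs_onD[OF act_in[OF assms(2)]] by simp
  qed
qed

text \<open>The relations hold for every \<open>t\<close>: prepending an edge of \<open>E\<close>
  never makes a path too short, so a ghost edge undoes its edge even after truncation.\<close>

lemma act_relation:
  assumes "wf_digraph E" "a \<in> cohn_relations E" "f \<in> funs_on (paths E t)"
  shows "act E t a f = 0"
proof -
  interpret wf_digraph E by fact
  have f: "f p = 0" if "p \<notin> paths E t" for p using assms(3) that by (rule funs_onD)
  have VV: "gen_act E t (Vert v) (gen_act E t (Vert w) f) = (if v = w then gen_act E t (Vert w) f else 0)"
    for v w by (auto simp: gen_act_def fun_eq_iff)
  have TE: "gen_act E t (Vert (tail E e)) (gen_act E t (Edge e) f) = gen_act E t (Edge e) f" for e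
  proof
    fix p :: "'b list \<times> 'a"
    show "gen_act E t (Vert (tail E e)) (gen_act E t (Edge e) f) p = gen_act E t (Edge e) f p"
      by (cases "(E, Edge e :: ('a, 'b) cohn_gen, f, p)" rule: gen_val.cases) (auto simp: gen_act_def)
  qed
  \<comment> \<open>At a path \<open>(e # es, w)\<close> the edge reads \<open>f\<close> at
    \<open>(es, w)\<close>, which may be too short for \<open>paths E t\<close>; there
    \<open>f\<close> vanishes by assumption.\<close>
  have EH: "gen_act E t (Edge e) (gen_act E t (Vert (head E e)) f) = gen_act E t (Edge e) f" for e
  proof
    fix p :: "'b list \<times> 'a"
    show "gen_act E t (Edge e) (gen_act E t (Vert (head E e)) f) p = gen_act E t (Edge e) f p"
      by (cases "(E, Edge e :: ('a, 'b) cohn_gen, f, p)" rule: gen_val.cases)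
        (auto simp: gen_act_def f)
  qed
  have HG: "gen_act E t (Vert (head E e)) (gen_act E t (Ghost e) f) = gen_act E t (Ghost e) f" for e
    by (auto simp: gen_act_def fun_eq_iff)
  have GT: "gen_act E t (Ghost e) (gen_act E t (Vert (tail E e)) f) = gen_act E t (Ghost e) f" for e
    by (auto simp: gen_act_def fun_eq_iff f)
  have GE: "gen_act E t (Ghost e) (gen_act E t (Edge e') f)
      = (if e = e' then gen_act E t (Vert (head E e)) f else 0)" if "e \<in> arcs E" for e e'
    using that by (auto simp: gen_act_def fun_eq_iff paths_def)
  show ?thesis
    using assms(2) unfolding cohn_relations_def
    by (auto simp: act_diff act_mult act_gen VV TE EH HG GT GE)
qed

lemma act_cohn_ideal:
  assumes "wf_digraph E" "a \<in> cohn_ideal E" "f \<in> funs_on (paths E t)"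
  shows "act E t a f = 0"
  using assms(2,3) unfolding cohn_ideal_def
\<comment> \<open>For a right multiple \<open>a * x\<close> the induction hypothesis is applied to
  the vector \<open>act E t x f\<close>, which again has the required support.\<close>
proof (induction arbitrary: f)
  case (base a)
  then show ?case by (rule act_relation[OF assms(1)])
qed (simp_all add: act_add act_mult act_in act_fun_zero)

lemma act_cong_ideal:
  assumes "wf_digraph E" "a - b \<in> cohn_ideal E" "f \<in> funs_on (paths E t)"
  shows "act E t a f = act E t b f"
  using act_cohn_ideal[OF assms] by (simp add: act_diff)

text \<open>Truncating at length one fails to commute with an edge only at the vertices, so every word
  commutes with the truncation up to a finite set of paths.\<close>

lemma word_act_agree:
  fixes E :: "('v, 'e) pre_digraph"
  assumes "wf_digraph E" "set ws \<subseteq> cohn_gens E"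
  shows "\<exists>Q. finite Q \<and> (\<forall>f :: 'e list \<times> 'v \<Rightarrow> 'k::field. \<forall>p \<in> paths E 1 - Q.
    foldr (gen_act E 1) ws (\<lambda>p. if p \<in> paths E 1 then f p else 0) p
      = foldr (gen_act E 0) ws f p)"
  using assms(2)
proof (induction ws)
  case Nil
  show ?case by (intro exI[of _ "{}"]) simp
next
  case (Cons g ws)
  then obtain Q where Q: "finite Q" "\<forall>f :: 'e list \<times> 'v \<Rightarrow> 'k. \<forall>p \<in> paths E 1 - Q.
    foldr (gen_act E 1) ws (\<lambda>p. if p \<in> paths E 1 then f p else 0) p
      = foldr (gen_act E 0) ws f p"
    by auto
  interpret wf_digraph E by fact
  \<comment> \<open>One more letter enlarges the exceptional set, but keeps it finite:
    \<open>gen_val\<close> reads its argument at a single path, obtained by a change at the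
    front.\<close>
  have "\<exists>Q'. finite Q' \<and> (\<forall>(h :: 'e list \<times> 'v \<Rightarrow> 'k) h' p. (\<forall>q \<in> paths E 1 - Q. h q = h' q) \<longrightarrow>
      p \<in> paths E 1 - Q' \<longrightarrow> gen_val E g h p = gen_val E g h' p)"
  proof (cases g)
    case (Vert v)
    then show ?thesis using Q(1) by (intro exI[of _ Q]) simp
  next
    case (Edge e)
    then have "head E e \<in> verts E" using Cons.prems by (auto simp: cohn_gens_def)
    \<comment> \<open>An edge reads the path without its first edge. Besides extensions of
      exceptional paths, the path consisting of \<open>e\<close> alone is exceptional, since what
      remains of it is a vertex, outside \<open>paths E 1\<close>.\<close>
    let ?Q = "(\<lambda>(es, w). (e # es, w)) ` insert ([], head E e) Q"
    have "gen_val E g h p = gen_val E g h' p"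
      if h: "\<forall>q \<in> paths E 1 - Q. h q = h' q" and p: "p \<in> paths E 1 - ?Q" for h h' :: "'e list \<times> 'v \<Rightarrow> 'k" and p
    proof (cases p)
      case (Pair es w)
      show ?thesis
      proof (cases es)
        case Nil
        then show ?thesis using Pair Edge by simp
      next
        case es: (Cons e' es')
        have "h (es', w) = h' (es', w)" if *: "e' = e" "src E (es', w) = head E e"
        proof -
          have "(es', w) \<notin> insert ([], head E e) Q" using p Pair es *(1) by force
          moreover from this have "es' \<noteq> []" using *(2) by auto
          ultimately show ?thesis
            using h *(2) \<open>head E e \<in> verts E\<close> by (cases es') (auto simp: paths_def)
        qed
        then show ?thesis using Pair es Edge by simp
      qed
    qed
    then show ?thesis using Q(1) by (intro exI[of _ ?Q] conjI allI impI finite_imageI finite.insertI)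
  next
    case (Ghost e)
    then have "tail E e \<in> verts E" using Cons.prems by (auto simp: cohn_gens_def)
    \<comment> \<open>A ghost edge reads \<open>(e # es, w)\<close>, so trouble arises only where
      this lies in \<open>Q\<close>; removing the first edge of every member of \<open>Q\<close>
      covers these paths.\<close>
    let ?Q = "(\<lambda>(es, w). (tl es, w)) ` Q"
    have "gen_val E g h p = gen_val E g h' p"
      if h: "\<forall>q \<in> paths E 1 - Q. h q = h' q" and p: "p \<in> paths E 1 - ?Q" for h h' :: "'e list \<times> 'v \<Rightarrow> 'k" and p
    proof (cases p)
      case (Pair es w)
      have "(e # es, w) \<notin> Q" using p Pair by force
      then have "h (e # es, w) = h' (e # es, w)"
        using h \<open>tail E e \<in> verts E\<close> by (auto simp: paths_def)
      then show ?thesis using Pair Ghost by simp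
    qed
    then show ?thesis using Q(1) by (intro exI[of _ ?Q] conjI allI impI finite_imageI finite.insertI)
  qed
  then obtain Q' where Q': "finite Q'" "\<forall>(h :: 'e list \<times> 'v \<Rightarrow> 'k) h' p. (\<forall>q \<in> paths E 1 - Q. h q = h' q) \<longrightarrow>
      p \<in> paths E 1 - Q' \<longrightarrow> gen_val E g h p = gen_val E g h' p"
    by blast
  have "foldr (gen_act E 1) (g # ws) (\<lambda>p. if p \<in> paths E 1 then f p else 0) p
        = foldr (gen_act E 0) (g # ws) f p" if p: "p \<in> paths E 1 - Q'" for f :: "'e list \<times> 'v \<Rightarrow> 'k" and p
  proof -
    have "p \<in> paths E 0" using p by (auto simp: paths_def)
    moreover have "gen_val E g
        (foldr (gen_act E 1) ws (\<lambda>p. if p \<in> paths E 1 then f p else 0)) p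
        = gen_val E g (foldr (gen_act E 0) ws f) p"
      by (rule Q'(2)[rule_format, OF Q(2)[rule_format] p])
    ultimately show ?thesis using p by (simp add: gen_act_def)
  qed
  then show ?case using Q'(1) by (intro exI[of _ Q'] conjI allI ballI)
qed

text \<open>An element has finitely many words, and the union of their exceptional sets is
  finite.\<close>

lemma act_agree:
  fixes E :: "('v, 'e) pre_digraph" and a :: "(('v, 'e) cohn_gen, 'k::field) free_alg"
  assumes "wf_digraph E" "a \<in> carrier (free_algebra (cohn_gens E))"
  shows "\<exists>Q. finite Q \<and> (\<forall>f. \<forall>p \<in> paths E 1 - Q.
    act E 1 a (\<lambda>p. if p \<in> paths E 1 then f p else 0) p = act E 0 a f p)"
proof -
  have "\<forall>w\<in>Poly_Mapping.keys a. \<exists>Q. finite Q \<and>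
      (\<forall>f :: 'e list \<times> 'v \<Rightarrow> 'k. \<forall>p \<in> paths E 1 - Q.
        foldr (gen_act E 1) (letters w) (\<lambda>p. if p \<in> paths E 1 then f p else 0) p
        = foldr (gen_act E 0) (letters w) f p)"
    by (intro ballI word_act_agree) (use assms in \<open>auto simp: free_algebra_carrier\<close>)
  from bchoice[OF this] obtain Q where Q: "\<forall>w\<in>Poly_Mapping.keys a. finite (Q w) \<and>
      (\<forall>f :: 'e list \<times> 'v \<Rightarrow> 'k. \<forall>p \<in> paths E 1 - Q w.
        foldr (gen_act E 1) (letters w) (\<lambda>p. if p \<in> paths E 1 then f p else 0) p
        = foldr (gen_act E 0) (letters w) f p)"
    by blast
  show ?thesis
  proof (intro exI[of _ "\<Union> (Q ` Poly_Mapping.keys a)"] conjI allI ballI)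
    show "finite (\<Union> (Q ` Poly_Mapping.keys a))" using Q by simp
    fix f :: "'e list \<times> 'v \<Rightarrow> 'k" and p
    assume "p \<in> paths E 1 - \<Union> (Q ` Poly_Mapping.keys a)"
    then show "act E 1 a (\<lambda>p. if p \<in> paths E 1 then f p else 0) p = act E 0 a f p"
      unfolding act_def sum_fun_apply fun_scale_def using Q
      by (intro sum.cong refl arg_cong2[of _ _ _ _ "(*)"]) blast
  qed
qed

text \<open>Tuples of functions are uncurried to functions on pairs of an index and a path, so that
  the results on dimension apply to them directly.\<close>

definition mat_act :: "('v, 'e) pre_digraph \<Rightarrow> nat \<Rightarrow> nat \<Rightarrow> nat
    \<Rightarrow> (nat \<Rightarrow> nat \<Rightarrow> (('v, 'e) cohn_gen, 'k) free_alg)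
    \<Rightarrow> (nat \<times> 'e list \<times> 'v \<Rightarrow> 'k) \<Rightarrow> (nat \<times> 'e list \<times> 'v \<Rightarrow> 'k::field)"
  where "mat_act E t n m a f = (\<lambda>(i, p).
    if i < n then \<Sum>j<m. act E t (a i j) (\<lambda>q. f (j, q)) p else 0)"

lemma linear_mat_act: "Vector_Spaces.linear fun_scale fun_scale (mat_act E t n m a)"
proof (rule fun_linearI)
  interpret A: Vector_Spaces.linear fun_scale fun_scale "act E t (a i j)" for i j
    by (rule linear_act)
  show "mat_act E t n m a (f + g) = mat_act E t n m a f + mat_act E t n m a g" for f g
    using A.add[of _ _ "\<lambda>q. f (_, q)" "\<lambda>q. g (_, q)"]
    by (auto simp: mat_act_def fun_eq_iff plus_fun_def sum.distrib)
  show "mat_act E t n m a (fun_scale c f) = fun_scale c (mat_act E t n m a f)" for c f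
    using A.scale[of _ _ c "\<lambda>q. f (_, q)"]
    by (auto simp: mat_act_def fun_eq_iff fun_scale_def sum_distrib_left)
qed

lemma mat_act_in:
  assumes "f \<in> funs_on ({..<m} \<times> paths E t)"
  shows "mat_act E t n m a f \<in> funs_on ({..<n} \<times> paths E t)"
proof -
  have "act E t (a i j) (\<lambda>q. f (j, q)) p = 0" if "p \<notin> paths E t" for i j p
    using assms that by (intro funs_onD[OF act_in]) (auto simp: funs_on_def)
  then show ?thesis by (auto simp: mat_act_def funs_on_def)
qed

text \<open>An inverse modulo the ideal suffices, because the ideal acts as zero and the sum of the
  vertices as the identity.\<close>

lemma mat_act_inverse:
  fixes a b :: "nat \<Rightarrow> nat \<Rightarrow> (('v, 'e) cohn_gen, 'k::field) free_alg"
  assumes E: "fin_digraph E"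
    and ab: "\<And>i k. i < n \<Longrightarrow> k < n \<Longrightarrow>
      (\<Sum>j<m. a i j * b j k) - (if i = k then \<Sum>v\<in>verts E. gen (Vert v) else 0) \<in> cohn_ideal E"
    and f: "f \<in> funs_on ({..<n} \<times> paths E t)"
  shows "mat_act E t n m a (mat_act E t m n b f) = f"
proof
  interpret fin_digraph E by fact
  interpret A: Vector_Spaces.linear fun_scale fun_scale "act E t c" for c
    by (rule linear_act)
  fix x :: "nat \<times> 'e list \<times> 'v"
  obtain i p where x: "x = (i, p)" by (cases x)
  define g where "g = (\<lambda>k q. f (k, q))"
  have g: "g k \<in> funs_on (paths E t)" for k
    using f by (auto simp: g_def funs_on_def)
  show "mat_act E t n m a (mat_act E t m n b f) x = f x"
  proof (cases "i < n")
    case False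
    then have "x \<notin> {..<n} \<times> paths E t" using x by simp
    then show ?thesis using False x funs_onD[OF f] by (simp add: mat_act_def)
  next
    case True
    have slice: "(\<lambda>q. mat_act E t m n b f (j, q)) = (\<Sum>k<n. act E t (b j k) (g k))" if "j < m" for j
      using that by (simp add: mat_act_def g_def fun_eq_iff sum_fun_apply)
    have "mat_act E t n m a (mat_act E t m n b f) x
        = (\<Sum>j<m. act E t (a i j) (\<Sum>k<n. act E t (b j k) (g k))) p"
      using True x slice by (simp add: mat_act_def[of E t n] sum_fun_apply)
    also have "(\<Sum>j<m. act E t (a i j) (\<Sum>k<n. act E t (b j k) (g k)))
        = (\<Sum>k<n. act E t (\<Sum>j<m. a i j * b j k) (g k))"
      unfolding A.sum act_sum act_mult by (rule sum.swap)
    also have "\<dots> = (\<Sum>k<n. if i = k then g k else 0)"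
      using act_cong_ideal[OF wf_digraph ab[OF True] g] g
      by (intro sum.cong) (auto simp: act_unit)
    also have "\<dots> = g i" using True by simp
    finally show ?thesis using x by (simp add: g_def)
  qed
qed

section \<open>The index argument\<close>

text \<open>The matrices live over the free algebra and are mutually inverse modulo the ideal. The
  carrier condition on \<open>a\<close> makes \<open>act_agree\<close> available for its
  entries.\<close>

lemma cohn_invertible_matrix_square:
  fixes a b :: "nat \<Rightarrow> nat \<Rightarrow> (('v, 'e) cohn_gen, 'k::field) free_alg"
  assumes E: "fin_digraph E" "verts E \<noteq> {}"
    and a: "\<And>i j. i < n \<Longrightarrow> j < m \<Longrightarrow> a i j \<in> carrier (free_algebra (cohn_gens E))"
    and ab: "\<And>i k. i < n \<Longrightarrow> k < n \<Longrightarrow>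
      (\<Sum>j<m. a i j * b j k) - (if i = k then \<Sum>v\<in>verts E. gen (Vert v) else 0) \<in> cohn_ideal E"
    and ba: "\<And>i k. i < m \<Longrightarrow> k < m \<Longrightarrow>
      (\<Sum>j<n. b i j * a j k) - (if i = k then \<Sum>v\<in>verts E. gen (Vert v) else 0) \<in> cohn_ideal E"
  shows "m = n"
proof -
  interpret fin_digraph E by fact
  define V :: "nat \<Rightarrow> nat \<Rightarrow> (nat \<times> 'e list \<times> 'v \<Rightarrow> 'k) set"
    where "V t l = funs_on ({..<l} \<times> paths E t)" for t l
  \<comment> \<open>\<open>N\<close> consists of the paths of length zero, which are exactly those
    lost by the truncation \<open>res\<close>.\<close>
  define N :: "('e list \<times> 'v) set" where "N = {[]} \<times> verts E"
  define res :: "(nat \<times> 'e list \<times> 'v \<Rightarrow> 'k) \<Rightarrow> _"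
    where "res f = (\<lambda>(i, p). if p \<in> paths E 1 then f (i, p) else 0)" for f
  define A where "A t = mat_act E t n m a" for t
  define B where "B t = mat_act E t m n b" for t
  have linA: "Vector_Spaces.linear fun_scale fun_scale (A t)" for t
    unfolding A_def by (rule linear_mat_act)
  have linB: "Vector_Spaces.linear fun_scale fun_scale (B t)" for t
    unfolding B_def by (rule linear_mat_act)
  interpret A: Vector_Spaces.linear fun_scale fun_scale "A t" for t by (rule linA)
  interpret B: Vector_Spaces.linear fun_scale fun_scale "B t" for t by (rule linB)
  have linres: "Vector_Spaces.linear fun_scale fun_scale res"
    by (rule fun_linearI) (auto simp: res_def fun_eq_iff fun_scale_def)
  have AV: "A t f \<in> V t n" if "f \<in> V t m" for t f
    using that unfolding A_def V_def by (rule mat_act_in)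
  have BV: "B t f \<in> V t m" if "f \<in> V t n" for t f
    using that unfolding B_def V_def by (rule mat_act_in)
  have AB: "A t (B t f) = f" if "f \<in> V t n" for t f
    using that unfolding A_def B_def V_def by (intro mat_act_inverse E ab)
  have BA: "B t (A t f) = f" if "f \<in> V t m" for t f
    using that unfolding A_def B_def V_def by (intro mat_act_inverse E ba)
  have V10: "V 1 l \<subseteq> V 0 l" for l by (auto simp: V_def funs_on_def paths_def)
  have resV: "res f \<in> V 1 l" if "f \<in> V 0 l" for f l
    using that by (auto simp: res_def V_def funs_on_def paths_def)
  have res_id: "res f = f" if "f \<in> V 1 l" for f l
    using that by (auto simp: res_def V_def funs_on_def fun_eq_iff)
  have paths_split: "paths E 0 = paths E 1 \<union> N" "paths E 1 \<inter> N = {}"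
    by (auto simp: paths_def N_def src_def Suc_le_eq)
  have ker_res: "{f \<in> V 0 l. res f = 0} = funs_on ({..<l} \<times> N)" for l
    using paths_split by (auto simp: res_def V_def funs_on_def fun_eq_iff) blast+
  have dimN: "has_dim (funs_on ({..<l} \<times> N) :: (nat \<times> 'e list \<times> 'v \<Rightarrow> 'k) set)
      (l * card (verts E))" for l
    using has_dim_funs_on[of "{..<l} \<times> N"] by (simp add: N_def card_cartesian_product)
  have subV: "fun_vs.subspace (V t l)" for t l
    unfolding V_def by (rule subspace_funs_on)

  define F where "F = A 1 \<circ> res"
  define G where "G = res \<circ> A 0"
  have linF: "Vector_Spaces.linear fun_scale fun_scale F"
    unfolding F_def by (rule Vector_Spaces.linear_compose[OF linres linA])
  have linG: "Vector_Spaces.linear fun_scale fun_scale G"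
    unfolding G_def by (rule Vector_Spaces.linear_compose[OF linA linres])
  \<comment> \<open>The preimages are \<open>B 1 f\<close> for \<open>F\<close> and
    \<open>B 0 f\<close> for \<open>G\<close>: \<open>res\<close> fixes \<open>V 1\<close>, and
    \<open>V 1\<close> lies inside \<open>V 0\<close>.\<close>
  have surjF: "V 1 n \<subseteq> F ` V 0 m"
  proof
    fix f assume f: "f \<in> V 1 n"
    then have "F (B 1 f) = f" using res_id[OF BV[OF f]] AB[OF f] by (simp add: F_def)
    then show "f \<in> F ` V 0 m" using BV[OF f] V10 by (metis imageI subsetD)
  qed
  have surjG: "V 1 n \<subseteq> G ` V 0 m"
  proof
    fix f assume f: "f \<in> V 1 n"
    then have f0: "f \<in> V 0 n" using V10 by blast
    then have "G (B 0 f) = f" using res_id[OF f] AB[OF f0] by (simp add: G_def)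
    then show "f \<in> G ` V 0 m" using BV[OF f0] by (metis imageI)
  qed
  \<comment> \<open>\<open>A 1\<close> is injective on \<open>V 1 m\<close>, so \<open>F\<close> and
    \<open>res\<close> have the same kernel.\<close>
  have kerF: "{f \<in> V 0 m. F f = 0} = funs_on ({..<m} \<times> N)"
  proof -
    have "F f = 0 \<longleftrightarrow> res f = 0" if "f \<in> V 0 m" for f
      using BA[OF resV[OF that]] by (metis A.zero B.zero F_def comp_apply)
    then show ?thesis unfolding ker_res[symmetric] by blast
  qed
  have dimF: "has_dim {f \<in> V 0 m. F f = 0} (m * card (verts E))"
    unfolding kerF by (rule dimN)
  \<comment> \<open>\<open>A 0\<close> maps \<open>V 0 m\<close> bijectively to
    \<open>V 0 n\<close>, so the kernel of \<open>G\<close> is the preimage of the kernel of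
    \<open>res\<close> on \<open>V 0 n\<close> and has the same dimension.\<close>
  have dimG: "has_dim {f \<in> V 0 m. G f = 0} (n * card (verts E))"
  proof -
    have "f = 0" if "f \<in> V 0 m" "A 0 f = 0" for f
      using BA[OF that(1)] that(2) B.zero[of 0] by simp
    then have "{f \<in> V 0 m. A 0 f = 0} = {0}"
      using fun_vs.subspace_0[OF subV] A.zero by auto
    moreover have "funs_on ({..<n} \<times> N) \<subseteq> A 0 ` V 0 m"
    proof
      fix f :: "nat \<times> 'e list \<times> 'v \<Rightarrow> 'k" assume "f \<in> funs_on ({..<n} \<times> N)"
      then have "f \<in> V 0 n" unfolding ker_res[symmetric] by blast
      then show "f \<in> A 0 ` V 0 m" using AB BV by (metis imageI)
    qed
    ultimately have "has_dim {f \<in> V 0 m. A 0 f \<in> funs_on ({..<n} \<times> N)} (0 + n * card (verts E))"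
      by (intro has_dim_vimage linA subV dimN) (simp_all add: has_dim_zero)
    moreover have "{f \<in> V 0 m. A 0 f \<in> funs_on ({..<n} \<times> N)} = {f \<in> V 0 m. G f = 0}"
      unfolding ker_res[symmetric] using AV by (auto simp: G_def)
    ultimately show ?thesis by simp
  qed

  have "\<forall>x\<in>{..<n} \<times> {..<m}. \<exists>Q. finite Q \<and> (\<forall>f. \<forall>p \<in> paths E 1 - Q.
      act E 1 (case_prod a x) (\<lambda>p. if p \<in> paths E 1 then f p else 0) p = act E 0 (case_prod a x) f p)"
    by (intro ballI act_agree wf_digraph) (use a in auto)
  from bchoice[OF this] obtain q where q: "\<forall>x\<in>{..<n} \<times> {..<m}. finite (q x) \<and>
    (\<forall>f. \<forall>p \<in> paths E 1 - q x.
      act E 1 (case_prod a x) (\<lambda>p. if p \<in> paths E 1 then f p else 0) p = act E 0 (case_prod a x) f p)"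
    by blast
  \<comment> \<open>\<open>Q\<close> collects the exceptional paths of all entries of
    \<open>a\<close>. Intersecting with \<open>paths E 1\<close> puts \<open>Z\<close> inside
    \<open>V 1 n\<close>, hence inside the images of \<open>F\<close> and \<open>G\<close>.\<close>
  define Q where "Q = \<Union> (q ` ({..<n} \<times> {..<m})) \<inter> paths E 1"
  have finQ: "finite Q" unfolding Q_def using q by blast
  define Z :: "(nat \<times> 'e list \<times> 'v \<Rightarrow> 'k) set" where "Z = funs_on ({..<n} \<times> Q)"
  have subZ: "fun_vs.subspace Z" unfolding Z_def by (rule subspace_funs_on)
  have ZV: "Z \<subseteq> V 1 n" by (auto simp: Z_def V_def funs_on_def Q_def)
  have dimZ: "has_dim Z (card ({..<n} \<times> Q))"
    unfolding Z_def using finQ by (intro has_dim_funs_on) simp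
  \<comment> \<open>Off \<open>Q\<close> the entries of \<open>a\<close> act alike before and after
    restriction; beyond index \<open>n\<close> or at paths outside \<open>paths E 1\<close> both
    values are zero.\<close>
  have FG: "F f - G f \<in> Z" if f: "f \<in> V 0 m" for f
  proof -
    have "F f (i, p) = G f (i, p)" if ip: "(i, p) \<notin> {..<n} \<times> Q" for i p
    proof (cases "i < n \<and> p \<in> paths E 1")
      case True
      then have "act E 1 (a i j) (\<lambda>q. res f (j, q)) p = act E 0 (a i j) (\<lambda>q. f (j, q)) p" if "j < m" for j
        using q[rule_format, of "(i, j)"] ip that unfolding Q_def res_def by auto
      then show ?thesis using True by (simp add: F_def G_def A_def mat_act_def res_def)
    next
      case False
      then have "(i, p) \<notin> {..<n} \<times> paths E 1" by simp
      then show ?thesis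
        using AV[OF resV[OF f]] resV[OF AV[OF f]] unfolding F_def G_def V_def comp_apply
        by (simp add: funs_onD)
    qed
    then show ?thesis by (auto simp: Z_def funs_on_def)
  qed
  \<comment> \<open>Two surjections that differ by a map into the finite-dimensional Z have the same preimage of Z,
    hence kernels of the same dimension.\<close>
  have FGZ: "{f \<in> V 0 m. F f \<in> Z} = {f \<in> V 0 m. G f \<in> Z}"
  proof -
    have "F f \<in> Z \<longleftrightarrow> G f \<in> Z" if "f \<in> V 0 m" for f
      using FG[OF that] fun_vs.subspace_diff[OF subZ, of "F f" "F f - G f"]
        fun_vs.subspace_add[OF subZ, of "F f - G f" "G f"] by auto
    then show ?thesis by blast
  qed
  have "has_dim {f \<in> V 0 m. F f \<in> Z} (m * card (verts E) + card ({..<n} \<times> Q))"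
    using ZV surjF by (intro has_dim_vimage linF subV dimF dimZ) blast
  moreover have "has_dim {f \<in> V 0 m. F f \<in> Z} (n * card (verts E) + card ({..<n} \<times> Q))"
    unfolding FGZ using ZV surjG by (intro has_dim_vimage linG subV dimG dimZ) blast
  ultimately have "m * card (verts E) = n * card (verts E)"
    using has_dim_unique by fastforce
  \<comment> \<open>The vertex set is finite and nonempty, so its cardinality can be
    cancelled.\<close>
  then show ?thesis using E(2) by simp
qed

text \<open>A module isomorphism gives inverse matrices over the quotient. Representatives of their
  entries give matrices over the free algebra, inverse modulo the ideal, and such matrices are
  square.\<close>

theorem corollary2p7:
  fixes E :: "('v, 'e) pre_digraph"
  assumes "fin_digraph E" and "verts E \<noteq> {}"
  shows "invariant_basis_number
    (cohn_path_algebra E :: (('v, 'e) cohn_gen, 'k::field) free_alg set ring)"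
  unfolding invariant_basis_number_def
proof (intro conjI allI impI)
  interpret fin_digraph E by fact
  let ?F = "free_algebra (cohn_gens E) :: (('v, 'e) cohn_gen, 'k) free_alg ring"
  let ?I = "cohn_ideal E :: (('v, 'e) cohn_gen, 'k) free_alg set"
  let ?C = "cohn_path_algebra E :: (('v, 'e) cohn_gen, 'k) free_alg set ring"
  let ?u = "\<Sum>v\<in>verts E. gen (Vert v) :: (('v, 'e) cohn_gen, 'k) free_alg"
  show R: "ring ?C" using assms(1) by (rule ring_cohn_path_algebra)
  interpret C: ring ?C by (rule R)
  fix m n assume "\<exists>\<phi>. right_module_iso ?C m n \<phi>"
  then obtain \<phi> where iso: "right_module_iso ?C m n \<phi>" ..
  define c where "c = (\<lambda>x. ?I +>\<^bsub>?F\<^esub> x)"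
  have carr: "carrier ?C = c ` carrier ?F"
    by (auto simp: cohn_path_algebra_def FactRing_def A_RCOSETS_defs c_def a_r_coset_def r_coset_def)
  have eq: "c a = c b \<longleftrightarrow> a - b \<in> ?I" for a b
    by (simp add: c_def cohn_ideal_def ai_coset_eq)
  have add: "c a \<oplus>\<^bsub>?C\<^esub> c b = c (a + b)" for a b
    by (simp add: cohn_path_algebra_def FactRing_def c_def cohn_ideal_def ai_coset_add)
  have mult: "c a \<otimes>\<^bsub>?C\<^esub> c b = c (a * b)" if "a \<in> carrier ?F" "b \<in> carrier ?F" for a b
    using that ai_coset_mult[OF cohn_relations_subset[OF wf_digraph]]
    by (simp add: cohn_path_algebra_def FactRing_def c_def cohn_ideal_def)
  have one: "\<one>\<^bsub>?C\<^esub> = c ?u"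
    by (simp add: cohn_path_algebra_def c_def)
  have zero: "\<zero>\<^bsub>?C\<^esub> = c 0"
    by (simp add: cohn_path_algebra_def FactRing_def c_def free_coset)
  have finsum: "finsum ?C (\<lambda>j. c (x j)) {..<l} = c (\<Sum>j<l. x j)"
    if "\<And>j. j < l \<Longrightarrow> x j \<in> carrier ?F" for x and l :: nat
    using that
  proof (induction l)
    case (Suc l)
    then have "(\<lambda>j. c (x j)) \<in> {..<l} \<rightarrow> carrier ?C" "c (x l) \<in> carrier ?C" by (auto simp: carr)
    then show ?case using Suc by (simp add: lessThan_Suc add)
  qed (simp add: zero)
  obtain a b where a: "\<And>i j. i < n \<Longrightarrow> j < m \<Longrightarrow> a i j \<in> carrier ?C"
    and b: "\<And>i j. i < m \<Longrightarrow> j < n \<Longrightarrow> b i j \<in> carrier ?C"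
    and ab: "\<And>i k. i < n \<Longrightarrow> k < n \<Longrightarrow>
      finsum ?C (\<lambda>j. a i j \<otimes>\<^bsub>?C\<^esub> b j k) {..<m} = (if i = k then \<one>\<^bsub>?C\<^esub> else \<zero>\<^bsub>?C\<^esub>)"
    and ba: "\<And>i k. i < m \<Longrightarrow> k < m \<Longrightarrow>
      finsum ?C (\<lambda>j. b i j \<otimes>\<^bsub>?C\<^esub> a j k) {..<n} = (if i = k then \<one>\<^bsub>?C\<^esub> else \<zero>\<^bsub>?C\<^esub>)"
    using right_module_iso_matrices[OF R iso] by blast
  have "\<forall>i j. \<exists>x. i < n \<and> j < m \<longrightarrow> x \<in> carrier ?F \<and> a i j = c x"
    using a unfolding carr by blast
  then obtain a' where a': "\<And>i j. i < n \<Longrightarrow> j < m \<Longrightarrow> a' i j \<in> carrier ?F \<and> a i j = c (a' i j)"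
    by metis
  have "\<forall>i j. \<exists>x. i < m \<and> j < n \<longrightarrow> x \<in> carrier ?F \<and> b i j = c x"
    using b unfolding carr by blast
  then obtain b' where b': "\<And>i j. i < m \<Longrightarrow> j < n \<Longrightarrow> b' i j \<in> carrier ?F \<and> b i j = c (b' i j)"
    by metis
  \<comment> \<open>An entry of a matrix identity in the quotient becomes a congruence modulo the
    ideal; the unit of the quotient is represented by the sum of the vertices.\<close>
  have lift: "(\<Sum>j<l. x' j * y' j) - (if P then ?u else 0) \<in> ?I"
    if x: "\<And>j. j < l \<Longrightarrow> x' j \<in> carrier ?F \<and> x j = c (x' j)"
      and y: "\<And>j. j < l \<Longrightarrow> y' j \<in> carrier ?F \<and> y j = c (y' j)"
      and xy: "finsum ?C (\<lambda>j. x j \<otimes>\<^bsub>?C\<^esub> y j) {..<l} = (if P then \<one>\<^bsub>?C\<^esub> else \<zero>\<^bsub>?C\<^esub>)"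
    for l :: nat and x y x' y' P
  proof -
    have "finsum ?C (\<lambda>j. x j \<otimes>\<^bsub>?C\<^esub> y j) {..<l} = finsum ?C (\<lambda>j. c (x' j * y' j)) {..<l}"
      using x y by (intro C.finsum_cong') (auto simp: mult carr fa_mult)
    also have "\<dots> = c (\<Sum>j<l. x' j * y' j)"
      using x y by (intro finsum) (auto intro: fa_mult)
    finally have "c (\<Sum>j<l. x' j * y' j) = c (if P then ?u else 0)"
      using xy one zero by (cases P) simp_all
    then show ?thesis by (simp only: eq)
  qed
  show "m = n"
  proof (rule cohn_invertible_matrix_square[OF assms, of n m a' b'])
    show "a' i j \<in> carrier ?F" if "i < n" "j < m" for i j using a'[OF that] by blast
    show "(\<Sum>j<m. a' i j * b' j k) - (if i = k then ?u else 0) \<in> ?I" if "i < n" "k < n" for i k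
      by (rule lift[OF a'[OF that(1)] b'[OF _ that(2)] ab[OF that]])
    show "(\<Sum>j<n. b' i j * a' j k) - (if i = k then ?u else 0) \<in> ?I" if "i < m" "k < m" for i k
      by (rule lift[OF b'[OF that(1)] a'[OF _ that(2)] ba[OF that]])
  qed
qed

end
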